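(* Let $\{(x_i,y_i)\}_{i=1}^5\subset\mathbb{P}^2\times\mathbb{P}^2$ be in general position. Let $C$ be the unique conic through $x_1,\dots,x_5$; for $i=1,\dots,5$ let $H_i$ be the unique homography such that $y_j=H_ix_j$ for all $j\in\{1,\dots,5\}$ with $j\ne i$, and let $C_i':=H_i(C)$. Similarly, let $C'$ be the unique conic through $y_1,\dots,y_5$; for $j=1,\dots,5$ let $G_j$ be the unique homography such that $x_i=G_jy_i$ for all $i\in\{1,\dots,5\}$ with $i\neq j$, and let $C_j:=G_j(C')$. Then $(x_6,y_6)$ is the unique new point under which the $6\times9$ matrix $Z_6$ with rows $x_i^\top\otimes y_i^\top$, $i=1,\dots,6$, is rank deficient (i.e. $\operatorname{rank}(Z_6)<6$) if and only if $y_6$ is the unique intersection point of $\bigcap_{i=1}^5C_i'$ and $x_6$ is the unique intersection point of $\bigcap_{j=1}^5C_j$.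
   Context: $\mathbb{P}^2$ is the projective plane over $\mathbb{C}$; points are represented by nonzero column vectors and $\otimes$ is the Kronecker product. A homography is an element of $\mathrm{PGL}(3)$ acting on $\mathbb{P}^2$. "New" means different from the five given point pairs. Points in $\mathbb{P}^2$ are in general position if at most $2$ of them are in a line and at most $5$ of them are on a conic (for five points only the first condition matters). A collection of point pairs $\{(x_i,y_i)\}$ is in general position if (1) the $x_i$ are in general position and the $y_i$ are in general position, and (2) no more than $4$ of the pairs are related by a homography $Hx_i=y_i$.
   Formalization: The pair (x_6,y_6) is assumed new, i.e. different from the five given pairs; otherwise the "if" direction fails, e.g. for x_j=y_j (j≤4) and x_5≠y_5 on one conic through these points, where the intersections are {y_5} and {x_5}. *)

theory Defs
  imports "HOL-Analysis.Analysis"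
begin

definition proj_rel :: "complex^3 \<Rightarrow> complex^3 \<Rightarrow> bool" where
  "proj_rel u v \<longleftrightarrow> u \<noteq> 0 \<and> v \<noteq> 0 \<and> (\<exists>c. c \<noteq> 0 \<and> v = c *s u)"

lemma part_equivp_proj_rel: "part_equivp proj_rel"
proof (rule part_equivpI)
  show "\<exists>u. proj_rel u u"
    unfolding proj_rel_def by (rule exI[of _ "1 :: complex^3"]) (auto intro: exI[of _ 1])
  show "symp proj_rel"
  proof (rule sympI)
    fix u v assume "proj_rel u v"
    then obtain c where "u \<noteq> 0" "v \<noteq> 0" "c \<noteq> 0" "v = c *s u"
      unfolding proj_rel_def by blast
    then show "proj_rel v u"
      unfolding proj_rel_def by (auto intro!: exI[of _ "inverse c"] simp: vec_eq_iff)
  qed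
  show "transp proj_rel"
  proof (rule transpI)
    fix u v w assume "proj_rel u v" "proj_rel v w"
    then obtain c d where "u \<noteq> 0" "w \<noteq> 0" "c \<noteq> 0" "v = c *s u" "d \<noteq> 0" "w = d *s v"
      unfolding proj_rel_def by blast
    then show "proj_rel u w"
      unfolding proj_rel_def by (auto intro!: exI[of _ "d * c"] simp: vec_eq_iff)
  qed
qed

text \<open>The projective plane over the complex numbers. The function \<open>rep_proj_plane\<close> picks an
  arbitrary nonzero representative of a point; every notion below is homogeneous in the
  representatives, hence independent of this choice.\<close>

quotient_type proj_plane = "complex^3" / partial: proj_rel
  by (rule part_equivp_proj_rel)

definition is_line :: "proj_plane set \<Rightarrow> bool" where
  "is_line L \<longleftrightarrow> (\<exists>a :: complex^3. a \<noteq> 0 \<and>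
     L = {p. (\<Sum>k\<in>UNIV. a $ k * rep_proj_plane p $ k) = 0})"

text \<open>Conics are zero sets of nonzero ternary quadratic forms, possibly degenerate ones. The form
  is bilinear in the coordinates, so the sum below is not the real inner product of HOL-Analysis.\<close>

definition is_conic :: "proj_plane set \<Rightarrow> bool" where
  "is_conic C \<longleftrightarrow> (\<exists>Q :: complex^3^3. Q \<noteq> 0 \<and> transpose Q = Q \<and>
     C = {p. (\<Sum>k\<in>UNIV. rep_proj_plane p $ k * (Q *v rep_proj_plane p) $ k) = 0})"

text \<open>An element of PGL(3) is identified with the self-map of the projective plane that it
  induces.\<close>

definition is_homography :: "(proj_plane \<Rightarrow> proj_plane) \<Rightarrow> bool" where
  "is_homography f \<longleftrightarrow> (\<exists>A :: complex^3^3. invertible A \<and>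
     (\<forall>p. f p = abs_proj_plane (A *v rep_proj_plane p)))"

text \<open>Counting indices rather than points makes a point that occurs several times in the family
  count with its multiplicity.\<close>

definition points_general_position :: "('i::finite \<Rightarrow> proj_plane) \<Rightarrow> bool" where
  "points_general_position x \<longleftrightarrow>
     (\<forall>L. is_line L \<longrightarrow> card {i. x i \<in> L} \<le> 2) \<and>
     (\<forall>C. is_conic C \<longrightarrow> card {i. x i \<in> C} \<le> 5)"

definition pairs_general_position ::
    "('i::finite \<Rightarrow> proj_plane) \<Rightarrow> ('i \<Rightarrow> proj_plane) \<Rightarrow> bool" where
  "pairs_general_position x y \<longleftrightarrow>
     points_general_position x \<and> points_general_position y \<and>
     (\<forall>H. is_homography H \<longrightarrow> card {i. H (x i) = y i} \<le> 4)"

definition conic_through :: "('i \<Rightarrow> proj_plane) \<Rightarrow> proj_plane set" where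
  "conic_through x = (THE C. is_conic C \<and> (\<forall>i. x i \<in> C))"

definition homography_except ::
    "('i \<Rightarrow> proj_plane) \<Rightarrow> ('i \<Rightarrow> proj_plane) \<Rightarrow> 'i \<Rightarrow> proj_plane \<Rightarrow> proj_plane" where
  "homography_except x y i = (THE H. is_homography H \<and> (\<forall>j. j \<noteq> i \<longrightarrow> H (x j) = y j))"

text \<open>The Kronecker product of two vectors in \<open>complex^3\<close>, with its nine entries indexed by
  pairs.\<close>

definition kron :: "complex^3 \<Rightarrow> complex^3 \<Rightarrow> complex^(3 \<times> 3)" where
  "kron u v = (\<chi> kl. u $ fst kl * v $ snd kl)"

text \<open>The \<open>6 \<times> 9\<close> matrix for five pairs and a sixth one: row \<open>Some i\<close> belongs to the pair
  \<open>(x i, y i)\<close>, row \<open>None\<close> to the sixth pair. Its rank does not depend on the representatives,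
  since changing them rescales the rows by nonzero factors.\<close>

definition Z6 :: "(5 \<Rightarrow> proj_plane) \<Rightarrow> (5 \<Rightarrow> proj_plane) \<Rightarrow> proj_plane \<Rightarrow> proj_plane \<Rightarrow>
    complex^(3 \<times> 3)^(5 option)" where
  "Z6 x y x6 y6 = (\<chi> r. case r of
       Some i \<Rightarrow> kron (rep_proj_plane (x i)) (rep_proj_plane (y i))
     | None \<Rightarrow> kron (rep_proj_plane x6) (rep_proj_plane y6))"

definition is_new_pair ::
    "('i \<Rightarrow> proj_plane) \<Rightarrow> ('i \<Rightarrow> proj_plane) \<Rightarrow> proj_plane \<Rightarrow> proj_plane \<Rightarrow> bool" where
  "is_new_pair x y u v \<longleftrightarrow> (\<forall>i. (u, v) \<noteq> (x i, y i))"

end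

theory Submission
  imports Defs
begin

text \<open>
  Fix an index \<open>k\<close> and choose coordinates in both planes in which the four pairs other than
  the \<open>k\<close>-th become \<open>(e1, e1)\<close>, \<open>(e2, e2)\<close>, \<open>(e3, e3)\<close> and \<open>(1, 1)\<close>, where \<open>1\<close> is the unit
  point \<open>(1, 1, 1)\<close>, while \<open>x k\<close> and \<open>y k\<close> get coordinates \<open>a\<close> and \<open>b\<close> (\<open>proj_frame\<close>). In
  these coordinates \<open>H k\<close> is the identity, so \<open>C' k\<close> is the conic through
  \<open>e1, e2, e3, 1, a\<close>, whose equation \<open>conic_form a v = 0\<close> is explicit. The rank condition is
  explicit too: the first five rows are independent, so the rank drops for \<open>(u, v)\<close> exactly
  if the matrix \<open>u v\<^sup>T\<close> is a combination of the five matrices \<open>x i y i\<^sup>T\<close>, and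
  as three of these are the diagonal matrix units only the off-diagonal entries matter:
  \<open>u p * v q = s + t * a p * b q\<close> for \<open>p \<noteq> q\<close> (\<open>rank_Z6_less_iff\<close>).

  A solution with \<open>s = 0\<close> or \<open>t = 0\<close> is one of the five given pairs. For a new solution,
  eliminating \<open>t\<close> and \<open>u\<close> yields \<open>conic_form a v = 0\<close>, that is, \<open>v\<close> lies on \<open>C' k\<close>. Moreover
  \<open>u 1 v 2 \<cdot> u 2 v 3 \<cdot> u 3 v 1 = u 2 v 1 \<cdot> u 3 v 2 \<cdot> u 1 v 3\<close>, and
  since the terms in \<open>s^3\<close> and \<open>t^3\<close> cancel this is a linear condition on the ratio of \<open>s\<close>
  and \<open>t\<close>. One coefficient vanishes exactly if \<open>y k\<close> lies on \<open>C' k\<close>, the other exactly if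
  \<open>y m\<close> lies on \<open>C' m\<close>, where \<open>m\<close> is the index whose pair became \<open>(1, 1)\<close>. They cannot both
  vanish, for otherwise \<open>a\<close> and \<open>b\<close> would be proportional and one homography would match all
  five pairs. Hence a new solution forces \<open>y k \<notin> C' k\<close> for every \<open>k\<close>
  (\<open>rank_deficient_new_pair\<close>).

  If \<open>y k \<notin> C' k\<close> for all \<open>k\<close>, the \<open>C' k\<close> have at most one common point: the standard
  quadratic transformation \<open>v \<mapsto> (1 / v 1, 1 / v 2, 1 / v 3)\<close> turns \<open>C' k\<close> and
  \<open>C' m\<close>, which share \<open>e1, e2, e3\<close>, into two distinct lines (\<open>common_point_unique\<close>).
  Together with the symmetry between \<open>x\<close> and \<open>y\<close> this shows that a new solution is the pair
  of the common points of the two families of conics (\<open>Inter_image_conic\<close>); so it is unique,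
  and the implication from left to right holds.

  Conversely let the two intersections be \<open>{y6}\<close> and \<open>{x6}\<close>. If \<open>y k\<close> were on \<open>C' k\<close>, it
  would be on all \<open>C' n\<close> and likewise \<open>x k\<close> on all \<open>C n\<close> (\<open>own_point_imp_common_point\<close>), so
  \<open>(x6, y6)\<close> would be the pair \<open>(x k, y k)\<close>, which is not new. Therefore \<open>y k \<notin> C' k\<close>
  for all \<open>k\<close>, and then the linear condition can be solved and a new solution exists
  (\<open>rank_deficient_new_pair_exists\<close>). By the previous paragraph that solution is \<open>(x6, y6)\<close>.
\<close>

section \<open>Points and homographies in coordinates\<close>

abbreviation pt :: "complex^3 \<Rightarrow> proj_plane" where
  "pt \<equiv> abs_proj_plane"

lemma pt_eq_iff:
  assumes "u \<noteq> 0" "v \<noteq> 0"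
  shows "pt u = pt v \<longleftrightarrow> (\<exists>c. c \<noteq> 0 \<and> v = c *s u)"
proof -
  have r: "proj_rel w w" if "w \<noteq> 0" for w
    using that by (auto simp: proj_rel_def intro: exI[of _ 1])
  show ?thesis
    using Quotient3_rel[OF Quotient3_proj_plane, of u v] r[OF assms(1)] r[OF assms(2)] assms
    by (auto simp: proj_rel_def)
qed

lemma rep_nonzero: "rep_proj_plane p \<noteq> 0"
  using Quotient3_rep_reflp[OF Quotient3_proj_plane, of p] by (simp add: proj_rel_def)

lemma pt_rep: "pt (rep_proj_plane p) = p"
  by (rule Quotient3_abs_rep[OF Quotient3_proj_plane])

lemma rep_pt:
  assumes "v \<noteq> 0"
  obtains c where "c \<noteq> 0" "rep_proj_plane (pt v) = c *s v"
  using pt_eq_iff[OF assms rep_nonzero[of "pt v"]] pt_rep[of "pt v"] by metis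

lemma pt_scale: "v \<noteq> 0 \<Longrightarrow> c \<noteq> 0 \<Longrightarrow> pt (c *s v) = pt v"
  by (subst pt_eq_iff) (auto simp: vec_eq_iff intro!: exI[of _ "inverse c"])

lemma invertible_mult_eq_0_iff:
  fixes M :: "complex^'n^'n"
  assumes "invertible M"
  shows "M *v v = 0 \<longleftrightarrow> v = 0"
  using assms by (metis matrix_left_invertible_ker invertible_left_inverse matrix_vector_mult_0_right)

lemma invertible_ker: "(\<And>v. A *v v = 0 \<Longrightarrow> v = 0) \<Longrightarrow> invertible A"
  for A :: "complex^3^3"
  by (auto simp: invertible_left_inverse matrix_left_invertible_ker)

lemma matrix_inv_cancel:
  fixes M :: "complex^'n^'n"
  assumes "invertible M"
  shows "M ** matrix_inv M = mat 1" "matrix_inv M ** M = mat 1"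
proof -
  have "M ** matrix_inv M = mat 1 \<and> matrix_inv M ** M = mat 1"
    unfolding matrix_inv_def using assms unfolding invertible_def by (rule someI_ex)
  then show "M ** matrix_inv M = mat 1" "matrix_inv M ** M = mat 1" by auto
qed

lemma invertible_inverse_mult:
  fixes M :: "complex^'n^'n"
  assumes "invertible M"
  shows "M *v (matrix_inv M *v v) = v" "matrix_inv M *v (M *v v) = v"
  using assms by (simp_all add: matrix_vector_mul_assoc matrix_inv_cancel)

lemma pt_mult_eq_iff:
  fixes M :: "complex^3^3"
  assumes "invertible M" "u \<noteq> 0" "v \<noteq> 0"
  shows "pt (M *v u) = pt (M *v v) \<longleftrightarrow> (\<exists>c. c \<noteq> 0 \<and> v = c *s u)"
proof -
  have "M *v v = c *s (M *v u) \<longleftrightarrow> v = c *s u" for c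
    using invertible_inverse_mult(2)[OF assms(1), of v]
      invertible_inverse_mult(2)[OF assms(1), of "c *s u"]
    by (auto simp: vector_scalar_commute)
  then show ?thesis
    using assms by (simp add: pt_eq_iff invertible_mult_eq_0_iff)
qed

lemma pt_mult_scale:
  fixes M :: "complex^3^3"
  assumes "invertible M" "u \<noteq> 0" "c \<noteq> 0" "v = c *s u"
  shows "pt (M *v v) = pt (M *v u)"
  using assms by (simp add: vector_scalar_commute pt_scale invertible_mult_eq_0_iff)

lemma pt_coordinates:
  fixes M :: "complex^3^3"
  assumes "invertible M"
  obtains v where "v \<noteq> 0" "p = pt (M *v v)"
proof
  show "p = pt (M *v (matrix_inv M *v rep_proj_plane p))"
    by (simp add: invertible_inverse_mult(1)[OF assms] pt_rep)
  show "matrix_inv M *v rep_proj_plane p \<noteq> 0"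
    using invertible_inverse_mult(1)[OF assms, of "rep_proj_plane p"] rep_nonzero[of p] by auto
qed

lemma complex_vec3_eq_iff: "u = v \<longleftrightarrow> u $ 1 = v $ 1 \<and> u $ 2 = v $ 2 \<and> u $ 3 = v $ 3"
  for u v :: "complex^3"
  by (simp add: vec_eq_iff forall_3)

lemma homography_pt:
  assumes "is_homography f"
  obtains A where "invertible A" "\<And>v. v \<noteq> 0 \<Longrightarrow> f (pt v) = pt (A *v v)"
proof -
  obtain A where A: "invertible A" "\<And>p. f p = pt (A *v rep_proj_plane p)"
    using assms unfolding is_homography_def by blast
  have "f (pt v) = pt (A *v v)" if v: "v \<noteq> 0" for v
  proof -
    obtain c where "c \<noteq> 0" "rep_proj_plane (pt v) = c *s v" using rep_pt[OF v] .
    then show ?thesis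
      using A v by (simp add: vector_scalar_commute pt_scale invertible_mult_eq_0_iff)
  qed
  with A(1) show thesis by (rule that)
qed

text \<open>
  A homography is used only through its effect on coordinates: with bases \<open>M\<close> and \<open>N\<close> of the
  two planes, the homography below leaves coordinate vectors unchanged.
\<close>

lemma homography_between_coordinates:
  fixes M N :: "complex^3^3"
  assumes "invertible M" "invertible N"
  obtains f where "is_homography f" "\<And>v. v \<noteq> 0 \<Longrightarrow> f (pt (M *v v)) = pt (N *v v)"
proof -
  define A where "A = N ** matrix_inv M"
  have inv: "invertible A"
    unfolding A_def using matrix_inv_cancel[OF assms(1)]
    by (intro invertible_mult assms(2)) (auto simp: invertible_def)
  define f where "f p = pt (A *v rep_proj_plane p)" for p
  have hom: "is_homography f"
    unfolding is_homography_def f_def using inv by blast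
  moreover have "f (pt (M *v v)) = pt (N *v v)" if "v \<noteq> 0" for v
  proof -
    have Mv: "M *v v \<noteq> 0" using that assms by (simp add: invertible_mult_eq_0_iff)
    obtain c where c: "c \<noteq> 0" "rep_proj_plane (pt (M *v v)) = c *s (M *v v)"
      using rep_pt[OF Mv] .
    have "A *v (M *v v) = N *v v"
      by (simp add: A_def matrix_vector_mul_assoc[symmetric] invertible_inverse_mult(2)[OF assms(1)])
    then show ?thesis
      using c that assms
      by (simp add: f_def vector_scalar_commute pt_scale invertible_mult_eq_0_iff)
  qed
  ultimately show thesis by (rule that)
qed

section \<open>The conic through five points\<close>

text \<open>
  The quadratic form of the conic through \<open>e1, e2, e3, (1, 1, 1)\<close> and \<open>a\<close>. Divided by
  \<open>v$1 * v$2 * v$3\<close> it is linear in the reciprocals of the entries of \<open>v\<close>, and it is the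
  line that joins \<open>(1, 1, 1)\<close> to the reciprocal of \<open>a\<close>.
\<close>

definition conic_form :: "complex^3 \<Rightarrow> complex^3 \<Rightarrow> complex" where
  "conic_form a v = a$1 * (a$2 - a$3) * v$2 * v$3 + a$2 * (a$3 - a$1) * v$1 * v$3
     + a$3 * (a$1 - a$2) * v$1 * v$2"

text \<open>
  The columns of \<open>M\<close> represent \<open>x i\<close>, \<open>x j\<close>, \<open>x l\<close>, scaled so that their sum represents
  \<open>x m\<close>; the vector \<open>a\<close> holds the coordinates of the remaining point \<open>x k\<close>. The conditions
  on the entries of \<open>a\<close> are what general position says about it: \<open>x k\<close> lies on none of the
  six lines that join two of the other points. The indices are arguments because the proof
  changes the omitted index \<open>k\<close>.
\<close>

definition proj_frame ::
    "('i \<Rightarrow> proj_plane) \<Rightarrow> complex^3^3 \<Rightarrow> complex^3 \<Rightarrow> 'i \<Rightarrow> 'i \<Rightarrow> 'i \<Rightarrow> 'i \<Rightarrow> 'i \<Rightarrow> bool" where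
  "proj_frame x M a i j l m k \<longleftrightarrow>
     distinct [i, j, l, m, k] \<and> UNIV = {i, j, l, m, k} \<and> invertible M \<and>
     x i = pt (M *v vector [1, 0, 0]) \<and> x j = pt (M *v vector [0, 1, 0]) \<and>
     x l = pt (M *v vector [0, 0, 1]) \<and> x m = pt (M *v vector [1, 1, 1]) \<and>
     x k = pt (M *v a) \<and>
     a$1 \<noteq> 0 \<and> a$2 \<noteq> 0 \<and> a$3 \<noteq> 0 \<and> a$1 \<noteq> a$2 \<and> a$1 \<noteq> a$3 \<and> a$2 \<noteq> a$3"

definition quad_form :: "complex^3^3 \<Rightarrow> complex^3 \<Rightarrow> complex" where
  "quad_form Q v = (\<Sum>k\<in>UNIV. v $ k * (Q *v v) $ k)"

lemma quad_form_scale: "quad_form Q (c *s v) = c^2 * quad_form Q v"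
  by (simp add: quad_form_def vector_scalar_commute sum_distrib_left power2_eq_square algebra_simps)

lemma quad_form_mult: "quad_form Q (M *v v) = quad_form (transpose M ** Q ** M) v"
  by (simp add: quad_form_def matrix_vector_mult_def matrix_matrix_mult_def transpose_def sum_3
      algebra_simps)

lemma quad_form_rep:
  assumes "v \<noteq> 0"
  shows "quad_form Q (rep_proj_plane (pt v)) = 0 \<longleftrightarrow> quad_form Q v = 0"
  using rep_pt[OF assms] by (metis mult_eq_0_iff power_not_zero quad_form_scale)

lemma is_conic_quad_form:
  "is_conic C \<longleftrightarrow> (\<exists>Q. Q \<noteq> 0 \<and> transpose Q = Q \<and> C = {p. quad_form Q (rep_proj_plane p) = 0})"
  by (simp add: is_conic_def quad_form_def)

lemma quad_form_symmetric:
  assumes "transpose Q = Q"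
  shows "quad_form Q v = Q$1$1 * (v$1)^2 + Q$2$2 * (v$2)^2 + Q$3$3 * (v$3)^2
    + 2 * (Q$2$3 * v$2 * v$3 + Q$1$3 * v$1 * v$3 + Q$1$2 * v$1 * v$2)"
proof -
  have s: "Q$i$j = Q$j$i" for i j
    using arg_cong[OF assms, of "\<lambda>A. A$i$j"] by (simp add: transpose_def)
  show ?thesis
    by (simp add: quad_form_def matrix_vector_mult_def sum_3 s[of 2 1] s[of 3 1] s[of 3 2]
        power2_eq_square algebra_simps)
qed

lemma quad_form_eq_0_imp:
  assumes Q: "transpose Q = Q" and z: "\<And>v. quad_form Q v = 0"
  shows "Q = 0"
proof -
  have s: "Q$i$j = Q$j$i" for i j
    using arg_cong[OF Q, of "\<lambda>A. A$i$j"] by (simp add: transpose_def)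
  have d: "Q$1$1 = 0" "Q$2$2 = 0" "Q$3$3 = 0"
    using z[of "vector [1,0,0]"] z[of "vector [0,1,0]"] z[of "vector [0,0,1]"]
    by (simp_all add: quad_form_symmetric[OF Q] vector_3)
  have "Q$2$3 = 0" "Q$1$3 = 0" "Q$1$2 = 0"
    using z[of "vector [0,1,1]"] z[of "vector [1,0,1]"] z[of "vector [1,1,0]"]
    by (simp_all add: quad_form_symmetric[OF Q] vector_3 d)
  then show ?thesis
    by (simp add: complex_vec3_eq_iff vec_eq_iff forall_3 d s[of 2 1] s[of 3 1] s[of 3 2])
qed

text \<open>
  Vanishing at the \<open>e\<close>-vectors kills the diagonal, and the two remaining conditions
  determine the three off-diagonal entries up to a common factor.
\<close>

lemma quad_form_through_frame:
  assumes Q: "transpose Q = Q"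
    and z: "quad_form Q (vector [1, 0, 0]) = 0" "quad_form Q (vector [0, 1, 0]) = 0"
      "quad_form Q (vector [0, 0, 1]) = 0" "quad_form Q (vector [1, 1, 1]) = 0" "quad_form Q a = 0"
    and a: "a$1 \<noteq> 0" "a$2 \<noteq> a$3"
  obtains c where "\<And>v. quad_form Q v = c * conic_form a v"
proof
  define c where "c = 2 * Q$2$3 / (a$1 * (a$2 - a$3))"
  have d: "Q$1$1 = 0" "Q$2$2 = 0" "Q$3$3 = 0"
    using z(1-3) by (simp_all add: quad_form_symmetric[OF Q] vector_3)
  have "2 * (Q$2$3 + Q$1$3 + Q$1$2) = 0"
    using z(4) d by (simp add: quad_form_symmetric[OF Q] vector_3)
  then have e1: "Q$1$2 = - Q$1$3 - Q$2$3" by algebra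
  have "2 * (Q$2$3 * a$2 * a$3 + Q$1$3 * a$1 * a$3 + Q$1$2 * a$1 * a$2) = 0"
    using z(5) d by (simp only: quad_form_symmetric[OF Q]) simp
  then have "Q$2$3 * a$2 * a$3 + Q$1$3 * a$1 * a$3 + Q$1$2 * a$1 * a$2 = 0"
    by (simp only: mult_eq_0_iff) simp
  then have e2: "Q$1$3 * (a$1 * (a$2 - a$3)) = Q$2$3 * (a$2 * (a$3 - a$1))"
    unfolding e1 by (simp add: algebra_simps)
  have "Q$1$3 = Q$2$3 * (a$2 * (a$3 - a$1)) / (a$1 * (a$2 - a$3))"
    using a e2 by (simp add: eq_divide_eq)
  then have c1: "2 * Q$1$3 = c * (a$2 * (a$3 - a$1))"
    by (simp add: c_def)
  have c2: "2 * Q$2$3 = c * (a$1 * (a$2 - a$3))"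
    using a by (simp add: c_def)
  have c3: "2 * Q$1$2 = c * (a$3 * (a$1 - a$2))"
    using c1 c2 e1 by algebra
  fix v
  have "quad_form Q v = 2 * Q$2$3 * v$2 * v$3 + 2 * Q$1$3 * v$1 * v$3 + 2 * Q$1$2 * v$1 * v$2"
    using d by (simp add: quad_form_symmetric[OF Q] algebra_simps)
  then show "quad_form Q v = c * conic_form a v"
    unfolding c1 c2 c3 by (simp add: conic_form_def algebra_simps)
qed

lemma proj_frame_vectors_nonzero:
  "(vector [1, 0, 0] :: complex^3) \<noteq> 0" "(vector [0, 1, 0] :: complex^3) \<noteq> 0"
  "(vector [0, 0, 1] :: complex^3) \<noteq> 0" "(vector [1, 1, 1] :: complex^3) \<noteq> 0"
  "a$1 \<noteq> 0 \<Longrightarrow> (a :: complex^3) \<noteq> 0"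
  by (auto simp: complex_vec3_eq_iff vector_3)

text \<open>
  Existence transports the matrix of \<open>conic_form a\<close> by \<open>M\<close>; uniqueness pulls any competing
  form back by \<open>M\<close> and applies \<open>quad_form_through_frame\<close>, after which the two forms differ
  by a nonzero factor.
\<close>

lemma conic_through_proj_frame:
  assumes F: "proj_frame x M a i j l m k"
  shows "conic_through x = {pt (M *v v) | v. v \<noteq> 0 \<and> conic_form a v = 0}" (is "_ = ?C")
  unfolding conic_through_def
proof (rule the_equality)
  have M: "invertible M" and U: "UNIV = {i, j, l, m, k}"
    and a: "a$1 \<noteq> 0" "a$2 \<noteq> a$3"
    and x: "x i = pt (M *v vector [1, 0, 0])" "x j = pt (M *v vector [0, 1, 0])"
     "x l = pt (M *v vector [0, 0, 1])" "x m = pt (M *v vector [1, 1, 1])" "x k = pt (M *v a)"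
    using F by (auto simp: proj_frame_def)
  note nz = proj_frame_vectors_nonzero
  have mem: "pt (M *v v) \<in> ?C \<longleftrightarrow> conic_form a v = 0" if "v \<noteq> 0" for v
  proof -
    have "conic_form a (c *s v) = c^2 * conic_form a v" for c
      by (simp add: conic_form_def power2_eq_square algebra_simps)
    then show ?thesis using that by (auto simp: pt_mult_eq_iff[OF M])
  qed
  have all: "(\<forall>n. P (x n)) \<longleftrightarrow> P (x i) \<and> P (x j) \<and> P (x l) \<and> P (x m) \<and> P (x k)" for P
    unfolding ball_UNIV[symmetric] U by simp
  have "pt (M *v vector [1, 0, 0]) \<in> ?C" "pt (M *v vector [0, 1, 0]) \<in> ?C"
    "pt (M *v vector [0, 0, 1]) \<in> ?C" "pt (M *v vector [1, 1, 1]) \<in> ?C" "pt (M *v a) \<in> ?C"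
    by (subst mem, simp add: nz a(1), simp add: conic_form_def vector_3 algebra_simps)+
  then have thr: "\<forall>n. x n \<in> ?C"
    by (simp only: all[of "\<lambda>p. p \<in> ?C"] x simp_thms)
  have zero_set: "{p. quad_form Q (rep_proj_plane p) = 0} = ?C"
    if "c \<noteq> 0" "\<And>v. quad_form Q (M *v v) = c * conic_form a v" for Q c
  proof -
    have "quad_form Q (rep_proj_plane p) = 0 \<longleftrightarrow> p \<in> ?C" for p
    proof -
      obtain v where v: "v \<noteq> 0" "p = pt (M *v v)" using pt_coordinates[OF M] .
      then show ?thesis
        using that M quad_form_rep[of "M *v v" Q] mem by (simp add: invertible_mult_eq_0_iff)
    qed
    then show ?thesis by blast
  qed
  show "is_conic ?C \<and> (\<forall>n. x n \<in> ?C)"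
  proof
    \<comment> \<open>The symmetric matrix whose quadratic form is twice \<open>conic_form a\<close>.\<close>
    define E :: "complex^3^3" where "E = vector [
      vector [0, a$3 * (a$1 - a$2), a$2 * (a$3 - a$1)],
      vector [a$3 * (a$1 - a$2), 0, a$1 * (a$2 - a$3)],
      vector [a$2 * (a$3 - a$1), a$1 * (a$2 - a$3), 0]]"
    define Q where "Q = transpose (matrix_inv M) ** E ** matrix_inv M"
    have E: "transpose E = E"
      by (simp add: E_def transpose_def vec_eq_iff forall_3 vector_3)
    have "quad_form Q (M *v v) = quad_form E v" for v
      unfolding Q_def quad_form_mult[symmetric] by (simp add: invertible_inverse_mult M)
    moreover have "quad_form E v = 2 * conic_form a v" for v
      unfolding quad_form_symmetric[OF E]
      by (simp add: E_def conic_form_def vector_3 algebra_simps)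
    ultimately have QE: "quad_form Q (M *v v) = 2 * conic_form a v" for v by simp
    have "Q \<noteq> 0"
    proof
      assume "Q = 0"
      then have "conic_form a (vector [0, 1, 1]) = 0"
        using QE[of "vector [0, 1, 1]"] by (simp add: quad_form_def)
      then show False using a by (simp add: conic_form_def vector_3)
    qed
    moreover have "transpose Q = Q"
      by (simp add: Q_def matrix_transpose_mul E matrix_mul_assoc)
    ultimately show "is_conic ?C"
      unfolding is_conic_quad_form using zero_set[of 2 Q] QE by auto
  qed (rule thr)
  fix C assume C: "is_conic C \<and> (\<forall>n. x n \<in> C)"
  then obtain Q where Q: "Q \<noteq> 0" "transpose Q = Q" "C = {p. quad_form Q (rep_proj_plane p) = 0}"
    unfolding is_conic_quad_form by blast
  define R where "R = transpose M ** Q ** M"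
  have R: "transpose R = R"
    by (simp add: R_def matrix_transpose_mul Q matrix_mul_assoc)
  have QR: "quad_form Q (M *v v) = quad_form R v" for v
    by (simp add: quad_form_mult R_def)
  have zero: "quad_form R v = 0" if "pt (M *v v) \<in> C" "v \<noteq> 0" for v
    using that quad_form_rep[of "M *v v" Q] M by (simp add: Q invertible_mult_eq_0_iff QR)
  have xs: "x i \<in> C" "x j \<in> C" "x l \<in> C" "x m \<in> C" "x k \<in> C" using C by auto
  obtain c where c: "\<And>v. quad_form R v = c * conic_form a v"
    using quad_form_through_frame[OF R _ _ _ _ _ a] zero[OF xs(1)[unfolded x]]
      zero[OF xs(2)[unfolded x]] zero[OF xs(3)[unfolded x]] zero[OF xs(4)[unfolded x]]
      zero[OF xs(5)[unfolded x]] nz a by blast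
  have "c \<noteq> 0"
  proof
    assume "c = 0"
    then have *: "quad_form Q w = 0" for w
      using c QR[of "matrix_inv M *v w"] by (simp add: invertible_inverse_mult M)
    then show False using quad_form_eq_0_imp[OF Q(2)] Q(1) by blast
  qed
  then show "C = ?C"
    using zero_set[of c Q] c QR Q(3) by simp
qed

section \<open>The homographies and the conics C'\<close>

text \<open>
  In the two frames that omit \<open>k\<close> the homography \<open>H k\<close> is the identity on coordinates.
  Uniqueness is the usual argument: a matrix with eigenvectors \<open>e1, e2, e3\<close> and \<open>(1, 1, 1)\<close>
  is a multiple of the identity.
\<close>

lemma homography_except_proj_frame:
  assumes X: "proj_frame x M a i j l m k" and Y: "proj_frame y N b i j l m k" and v: "v \<noteq> 0"
  shows "homography_except x y k (pt (M *v v)) = pt (N *v v)"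
proof -
  have M: "invertible M" and N: "invertible N"
    and U: "UNIV = {i, j, l, m, k}" and d: "distinct [i, j, l, m, k]"
    and x: "x i = pt (M *v vector [1, 0, 0])" "x j = pt (M *v vector [0, 1, 0])"
     "x l = pt (M *v vector [0, 0, 1])" "x m = pt (M *v vector [1, 1, 1])"
    and y: "y i = pt (N *v vector [1, 0, 0])" "y j = pt (N *v vector [0, 1, 0])"
     "y l = pt (N *v vector [0, 0, 1])" "y m = pt (N *v vector [1, 1, 1])"
    using X Y by (auto simp: proj_frame_def)
  note nz = proj_frame_vectors_nonzero
  have all: "(\<forall>n. n \<noteq> k \<longrightarrow> f (x n) = y n) \<longleftrightarrow>
      f (x i) = y i \<and> f (x j) = y j \<and> f (x l) = y l \<and> f (x m) = y m" for f
    unfolding ball_UNIV[symmetric] U using d by auto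
  obtain f where f: "is_homography f" "\<And>v. v \<noteq> 0 \<Longrightarrow> f (pt (M *v v)) = pt (N *v v)"
    using homography_between_coordinates[OF M N] by blast
  have coincide: "g (pt (M *v w)) = pt (N *v w)"
    if g: "is_homography g" "\<forall>n. n \<noteq> k \<longrightarrow> g (x n) = y n" and w: "w \<noteq> 0" for g w
  proof -
    obtain A where A: "invertible A" "\<And>v. v \<noteq> 0 \<Longrightarrow> g (pt v) = pt (A *v v)"
      using homography_pt[OF g(1)] by blast
    \<comment> \<open>the matrix of \<open>g\<close> in the coordinates given by \<open>M\<close> and \<open>N\<close>\<close>
    define B where "B = matrix_inv N ** A ** M"
    have NB: "N *v (B *v u) = A *v (M *v u)" for u
      by (simp add: B_def matrix_vector_mul_assoc[symmetric] invertible_inverse_mult(1)[OF N])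
    have gB: "g (pt (M *v u)) = pt (N *v (B *v u))" "B *v u \<noteq> 0" if "u \<noteq> 0" for u
    proof -
      have "M *v u \<noteq> 0" "A *v (M *v u) \<noteq> 0"
        using that A M by (simp_all add: invertible_mult_eq_0_iff)
      then show "g (pt (M *v u)) = pt (N *v (B *v u))" using A by (simp add: NB)
      show "B *v u \<noteq> 0" using \<open>A *v (M *v u) \<noteq> 0\<close> NB[of u] by auto
    qed
    have eig: "\<exists>c. c \<noteq> 0 \<and> B *v u = c *s u" if "u \<noteq> 0" "g (pt (M *v u)) = pt (N *v u)" for u
      using that gB[of u] pt_mult_eq_iff[OF N, of u "B *v u"] by auto
    have gx: "g (x i) = y i" "g (x j) = y j" "g (x l) = y l" "g (x m) = y m"
      using g(2) unfolding all by auto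
    obtain c1 c2 c3 c where
      c1: "B *v vector [1, 0, 0] = c1 *s vector [1, 0, 0]" and
      c2: "B *v vector [0, 1, 0] = c2 *s vector [0, 1, 0]" and
      c3: "B *v vector [0, 0, 1] = c3 *s vector [0, 0, 1]" and
      c: "c \<noteq> 0" "B *v vector [1, 1, 1] = c *s vector [1, 1, 1]"
      using eig[OF nz(1) gx(1)[unfolded x y]] eig[OF nz(2) gx(2)[unfolded x y]]
        eig[OF nz(3) gx(3)[unfolded x y]] eig[OF nz(4) gx(4)[unfolded x y]] by blast
    have "B *v w = c *s w"
      using c1 c2 c3 c(2)
      by (simp add: complex_vec3_eq_iff matrix_vector_mult_def sum_3 vector_3)
    then show ?thesis
      using gB(1)[OF w] c(1) w N by (simp add: vector_scalar_commute pt_scale invertible_mult_eq_0_iff)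
  qed
  have "homography_except x y k = f"
    unfolding homography_except_def
  proof (rule the_equality)
    show "is_homography f \<and> (\<forall>n. n \<noteq> k \<longrightarrow> f (x n) = y n)"
      unfolding all x y using f nz by simp
    fix g assume g: "is_homography g \<and> (\<forall>n. n \<noteq> k \<longrightarrow> g (x n) = y n)"
    show "g = f"
    proof
      fix p
      obtain w where "w \<noteq> 0" "p = pt (M *v w)" using pt_coordinates[OF M] .
      then show "g p = f p" using coincide f(2) g by simp
    qed
  qed
  then show ?thesis using f(2) v by simp
qed

lemma image_conic_proj_frame:
  assumes X: "proj_frame x M a i j l m k" and Y: "proj_frame y N b i j l m k"
  shows "homography_except x y k ` conic_through x
    = {pt (N *v v) | v. v \<noteq> 0 \<and> conic_form a v = 0}"
  unfolding conic_through_proj_frame[OF X]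
  using homography_except_proj_frame[OF X Y] by (auto simp: image_iff) metis+

lemma mem_image_conic:
  assumes X: "proj_frame x M a i j l m k" and Y: "proj_frame y N b i j l m k" and v: "v \<noteq> 0"
  shows "pt (N *v v) \<in> homography_except x y k ` conic_through x \<longleftrightarrow> conic_form a v = 0"
proof -
  have "conic_form a (c *s v) = c^2 * conic_form a v" for c
    by (simp add: conic_form_def power2_eq_square algebra_simps)
  moreover have "invertible N" using Y by (simp add: proj_frame_def)
  ultimately show ?thesis
    using v unfolding image_conic_proj_frame[OF X Y] by (auto simp: pt_mult_eq_iff)
qed

section \<open>Frames exist and can be reordered\<close>

text \<open>
  Collinearity of three points is tested in the coordinates of an arbitrary basis \<open>M\<close>: a
  linear form \<open>z\<close> on coordinates that kills all three would define a line through them. All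
  the inequalities in \<open>proj_frame\<close> come from suitable choices of \<open>z\<close>.
\<close>

lemma noncollinear:
  fixes x :: "'i::finite \<Rightarrow> proj_plane" and M :: "complex^3^3"
  assumes gp: "points_general_position x" and M: "invertible M" and d: "distinct [i, j, l]"
    and x: "x i = pt (M *v u1)" "x j = pt (M *v u2)" "x l = pt (M *v u3)"
    and nz: "u1 \<noteq> 0" "u2 \<noteq> 0" "u3 \<noteq> 0"
    and 0: "(\<Sum>k\<in>UNIV. z $ k * u1 $ k) = 0" "(\<Sum>k\<in>UNIV. z $ k * u2 $ k) = 0"
      "(\<Sum>k\<in>UNIV. z $ k * u3 $ k) = 0"
  shows "z = 0"
proof (rule ccontr)
  assume z: "z \<noteq> 0"
  define w where "w = z v* matrix_inv M"
  have w: "(\<Sum>k\<in>UNIV. w $ k * (M *v v) $ k) = (\<Sum>k\<in>UNIV. z $ k * v $ k)" for v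
  proof -
    have "(\<Sum>k\<in>UNIV. w $ k * t $ k) = (\<Sum>k\<in>UNIV. z $ k * (matrix_inv M *v t) $ k)" for t
      by (simp add: w_def vector_matrix_mult_def matrix_vector_mult_def sum_3 algebra_simps)
    then show ?thesis by (simp add: invertible_inverse_mult(2)[OF M])
  qed
  have "w \<noteq> 0"
  proof
    assume "w = 0"
    then have "(\<Sum>k\<in>UNIV. z $ k * v $ k) = 0" for v using w[of v] by simp
    from this[of "vector [1,0,0]"] this[of "vector [0,1,0]"] this[of "vector [0,0,1]"]
    show False using z by (simp add: sum_3 vector_3 complex_vec3_eq_iff)
  qed
  define L where "L = {p. (\<Sum>k\<in>UNIV. w $ k * rep_proj_plane p $ k) = 0}"
  have "pt (M *v v) \<in> L" if v: "(\<Sum>k\<in>UNIV. z $ k * v $ k) = 0" "v \<noteq> 0" for v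
  proof -
    have "M *v v \<noteq> 0" using v M by (simp add: invertible_mult_eq_0_iff)
    then obtain c where "rep_proj_plane (pt (M *v v)) = c *s (M *v v)" using rep_pt by blast
    then have "(\<Sum>k\<in>UNIV. w $ k * rep_proj_plane (pt (M *v v)) $ k)
        = c * (\<Sum>k\<in>UNIV. w $ k * (M *v v) $ k)"
      by (simp add: sum_distrib_left algebra_simps)
    then show ?thesis using v by (simp add: L_def w)
  qed
  then have "{i, j, l} \<subseteq> {n. x n \<in> L}" using 0 nz x by auto
  moreover have "card {i, j, l} = 3" using d by simp
  ultimately have "3 \<le> card {n. x n \<in> L}" by (metis card_mono finite)
  moreover have "is_line L" unfolding is_line_def L_def using \<open>w \<noteq> 0\<close> by blast
  ultimately show False using gp unfolding points_general_position_def by fastforce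
qed

lemma proj_frame_exists:
  fixes x :: "'i::finite \<Rightarrow> proj_plane"
  assumes gp: "points_general_position x" and d: "distinct [i, j, l, m, k]"
    and U: "UNIV = {i, j, l, m, k}"
  obtains M a where "proj_frame x M a i j l m k"
proof -
  define X where "X n = rep_proj_plane (x n)" for n
  have X: "x n = pt (mat 1 *v X n)" "X n \<noteq> 0" for n
    by (simp_all add: X_def pt_rep rep_nonzero)
  have I: "invertible (mat 1 :: complex^3^3)"
    using invertible_def matrix_mul_lid by blast
  define B :: "complex^3^3" where "B = (\<chi> r. vector [X i $ r, X j $ r, X l $ r])"
  have B: "invertible B"
  proof -
    have "z = 0" if "transpose B *v z = 0" for z
    proof (rule noncollinear[OF gp I _ X(1) X(1) X(1) X(2) X(2) X(2)])
      show "distinct [i, j, l]" using d by simp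
      show "(\<Sum>k\<in>UNIV. z $ k * X i $ k) = 0" "(\<Sum>k\<in>UNIV. z $ k * X j $ k) = 0"
        "(\<Sum>k\<in>UNIV. z $ k * X l $ k) = 0"
        using that by (simp_all add: complex_vec3_eq_iff matrix_vector_mult_def B_def transpose_def
            sum_3 vector_3 mult.commute)
    qed
    then have "invertible (transpose B)"
      by (auto simp: invertible_left_inverse matrix_left_invertible_ker)
    then show ?thesis
      by (metis invertible_left_inverse invertible_right_inverse left_invertible_transpose)
  qed
  have Bc: "B *v vector [p, q, r] = p *s X i + q *s X j + r *s X l" for p q r
    by (simp add: complex_vec3_eq_iff matrix_vector_mult_def B_def sum_3 vector_3 mult.commute)
  \<comment> \<open>The coordinates of \<open>x m\<close> in the basis \<open>X i, X j, X l\<close>; scaling the basis vectors by them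
    moves \<open>x m\<close> to the unit point.\<close>
  define t where "t = matrix_inv B *v X m"
  have t: "B *v t = X m" by (simp add: t_def invertible_inverse_mult(1)[OF B])
  have e: "B *v vector [1, 0, 0] = X i" "B *v vector [0, 1, 0] = X j" "B *v vector [0, 0, 1] = X l"
    by (simp_all add: Bc)
  note nz = proj_frame_vectors_nonzero
  have tz: "t \<noteq> 0" using t X(2)[of m] by auto
  have Bx: "x i = pt (B *v vector [1, 0, 0])" "x j = pt (B *v vector [0, 1, 0])"
     "x l = pt (B *v vector [0, 0, 1])" "x m = pt (B *v t)"
    unfolding e t by (simp_all add: X_def pt_rep)
  have dis: "distinct [j, l, m]" "distinct [i, l, m]" "distinct [i, j, m]"
    "distinct [j, l, k]" "distinct [i, l, k]" "distinct [i, j, k]"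
    "distinct [l, m, k]" "distinct [j, m, k]" "distinct [i, m, k]"
    using d by auto
  have t123: "t $ 1 \<noteq> 0" "t $ 2 \<noteq> 0" "t $ 3 \<noteq> 0"
    using noncollinear[OF gp B dis(1) Bx(2,3,4) nz(2,3) tz, of "vector [1,0,0]"]
      noncollinear[OF gp B dis(2) Bx(1,3,4) nz(1,3) tz, of "vector [0,1,0]"]
      noncollinear[OF gp B dis(3) Bx(1,2,4) nz(1,2) tz, of "vector [0,0,1]"] nz(1-3)
    by (auto simp: sum_3 vector_3)
  define M :: "complex^3^3" where "M = B ** vector [vector [t $ 1, 0, 0], vector [0, t $ 2, 0], vector [0, 0, t $ 3]]"
  have Mv: "M *v v = B *v vector [t $ 1 * v $ 1, t $ 2 * v $ 2, t $ 3 * v $ 3]" for v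
    unfolding M_def matrix_vector_mul_assoc[symmetric]
    by (rule arg_cong[where f = "\<lambda>w. B *v w"])
      (simp add: complex_vec3_eq_iff matrix_vector_mult_def sum_3 vector_3)
  have M: "invertible M"
  proof -
    have "v = 0" if "M *v v = 0" for v
    proof -
      have "vector [t $ 1 * v $ 1, t $ 2 * v $ 2, t $ 3 * v $ 3] = (0 :: complex^3)"
        using that unfolding Mv invertible_mult_eq_0_iff[OF B] .
      then show ?thesis using t123 by (simp add: complex_vec3_eq_iff vector_3)
    qed
    then show ?thesis by (auto simp: invertible_left_inverse matrix_left_invertible_ker)
  qed
  define a where "a = matrix_inv M *v X k"
  have a: "M *v a = X k" by (simp add: a_def invertible_inverse_mult(1)[OF M])
  have az: "a \<noteq> 0" using a X(2)[of k] by auto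
  have Mx: "x i = pt (M *v vector [1, 0, 0])" "x j = pt (M *v vector [0, 1, 0])"
     "x l = pt (M *v vector [0, 0, 1])" "x m = pt (M *v vector [1, 1, 1])" "x k = pt (M *v a)"
  proof -
    have "M *v vector [1, 0, 0] = t $ 1 *s X i" "M *v vector [0, 1, 0] = t $ 2 *s X j"
      "M *v vector [0, 0, 1] = t $ 3 *s X l"
      by (simp_all add: Mv Bc vector_3)
    then show "x i = pt (M *v vector [1, 0, 0])" "x j = pt (M *v vector [0, 1, 0])"
     "x l = pt (M *v vector [0, 0, 1])"
      using X(2) t123 by (simp_all add: pt_scale) (simp_all add: X_def pt_rep)
    have "vector [t $ 1, t $ 2, t $ 3] = t" by (simp add: complex_vec3_eq_iff vector_3)
    then show "x m = pt (M *v vector [1, 1, 1])" using t by (simp add: Mv vector_3 X_def pt_rep)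
    show "x k = pt (M *v a)" unfolding a by (simp add: X_def pt_rep)
  qed
  have "a$1 \<noteq> 0" "a$2 \<noteq> 0" "a$3 \<noteq> 0"
    using noncollinear[OF gp M dis(4) Mx(2,3,5) nz(2,3) az, of "vector [1,0,0]"]
      noncollinear[OF gp M dis(5) Mx(1,3,5) nz(1,3) az, of "vector [0,1,0]"]
      noncollinear[OF gp M dis(6) Mx(1,2,5) nz(1,2) az, of "vector [0,0,1]"] nz(1-3)
    by (auto simp: sum_3 vector_3)
  moreover have "a$1 \<noteq> a$2" "a$1 \<noteq> a$3" "a$2 \<noteq> a$3"
    using noncollinear[OF gp M dis(7) Mx(3,4,5) nz(3,4) az, of "vector [1,-1,0]"]
      noncollinear[OF gp M dis(8) Mx(2,4,5) nz(2,4) az, of "vector [1,0,-1]"]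
      noncollinear[OF gp M dis(9) Mx(1,4,5) nz(1,4) az, of "vector [0,1,-1]"]
    by (auto simp: sum_3 vector_3 complex_vec3_eq_iff)
  ultimately have "proj_frame x M a i j l m k"
    unfolding proj_frame_def using d U M Mx by blast
  then show thesis by (rule that)
qed

text \<open>
  The following four exchanges of indices generate all reorderings of the five points. They
  transfer what is computed for the omitted index \<open>k\<close> to the other indices without any new
  computation with homographies. Rescaling the axes by \<open>a\<close> makes \<open>x k\<close> the unit point.
\<close>

lemma proj_frame_swap_last:
  assumes "proj_frame x M a i j l m k"
  shows "proj_frame x (M ** vector [vector [a$1, 0, 0], vector [0, a$2, 0], vector [0, 0, a$3]])
    (vector [1 / a$1, 1 / a$2, 1 / a$3]) i j l k m" (is "proj_frame x (M ** ?T) ?a i j l k m")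
proof -
  note F = assms[unfolded proj_frame_def]
  have T: "(M ** ?T) *v v = M *v vector [a$1 * v$1, a$2 * v$2, a$3 * v$3]" for v
    unfolding matrix_vector_mul_assoc[symmetric]
    by (rule arg_cong[where f = "\<lambda>w. M *v w"])
      (simp add: complex_vec3_eq_iff matrix_vector_mult_def sum_3 vector_3)
  have "invertible ?T"
    using F by (intro invertible_ker) (simp add: complex_vec3_eq_iff matrix_vector_mult_def sum_3 vector_3)
  then have "invertible (M ** ?T)" using F invertible_mult by blast
  moreover have "pt (M *v vector [a$1, 0, 0]) = pt (M *v vector [1, 0, 0])"
      "pt (M *v vector [0, a$2, 0]) = pt (M *v vector [0, 1, 0])"
      "pt (M *v vector [0, 0, a$3]) = pt (M *v vector [0, 0, 1])"
    using F pt_mult_scale[of M "vector [1, 0, 0]" "a$1"] pt_mult_scale[of M "vector [0, 1, 0]" "a$2"]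
      pt_mult_scale[of M "vector [0, 0, 1]" "a$3"]
    by (auto simp: complex_vec3_eq_iff vector_3)
  moreover have "vector [a$1, a$2, a$3] = a" by (simp add: complex_vec3_eq_iff vector_3)
  moreover have "UNIV = {i, j, l, k, m}" "distinct [i, j, l, k, m]" using F by auto
  ultimately show ?thesis
    unfolding proj_frame_def T using F by (simp add: vector_3)
qed

lemma proj_frame_swap_third_fourth:
  assumes "proj_frame x M a i j l m k"
  shows "proj_frame x (M ** vector [vector [-1, 0, 1], vector [0, -1, 1], vector [0, 0, 1]])
    (vector [a$3 - a$1, a$3 - a$2, a$3]) i j m l k" (is "proj_frame x (M ** ?T) ?a i j m l k")
proof -
  note F = assms[unfolded proj_frame_def]
  have T: "(M ** ?T) *v v = M *v vector [v$3 - v$1, v$3 - v$2, v$3]" for v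
    unfolding matrix_vector_mul_assoc[symmetric]
    by (rule arg_cong[where f = "\<lambda>w. M *v w"])
      (simp add: complex_vec3_eq_iff matrix_vector_mult_def sum_3 vector_3)
  have "invertible ?T"
    by (intro invertible_ker) (auto simp: complex_vec3_eq_iff matrix_vector_mult_def sum_3 vector_3)
  then have "invertible (M ** ?T)" using F invertible_mult by blast
  moreover have "pt (M *v vector [-1, 0, 0]) = pt (M *v vector [1, 0, 0])"
      "pt (M *v vector [0, -1, 0]) = pt (M *v vector [0, 1, 0])"
    using F pt_mult_scale[of M "vector [1, 0, 0]" "-1"] pt_mult_scale[of M "vector [0, 1, 0]" "-1"]
    by (auto simp: complex_vec3_eq_iff vector_3)
  moreover have "vector [a$1, a$2, a$3] = a" by (simp add: complex_vec3_eq_iff vector_3)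
  moreover have "UNIV = {i, j, m, l, k}" "distinct [i, j, m, l, k]" using F by auto
  moreover have "a$3 \<noteq> a$1" "a$3 \<noteq> a$2" using F by auto
  ultimately show ?thesis
    unfolding proj_frame_def T using F by (simp add: vector_3)
qed

lemma proj_frame_swap_first_third:
  assumes "proj_frame x M a i j l m k"
  shows "proj_frame x (M ** vector [vector [0, 0, 1], vector [0, 1, 0], vector [1, 0, 0]])
    (vector [a$3, a$2, a$1]) l j i m k" (is "proj_frame x (M ** ?T) ?a l j i m k")
proof -
  note F = assms[unfolded proj_frame_def]
  have T: "(M ** ?T) *v v = M *v vector [v$3, v$2, v$1]" for v
    unfolding matrix_vector_mul_assoc[symmetric]
    by (rule arg_cong[where f = "\<lambda>w. M *v w"])
      (simp add: complex_vec3_eq_iff matrix_vector_mult_def sum_3 vector_3)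
  have "invertible ?T"
    by (intro invertible_ker) (auto simp: complex_vec3_eq_iff matrix_vector_mult_def sum_3 vector_3)
  then have "invertible (M ** ?T)" using F invertible_mult by blast
  moreover have "vector [a$1, a$2, a$3] = a"
    by (simp_all add: complex_vec3_eq_iff vector_3)
  moreover have "UNIV = {l, j, i, m, k}" "distinct [l, j, i, m, k]" using F by auto
  ultimately show ?thesis
    unfolding proj_frame_def T using F by (auto simp: vector_3)
qed

lemma proj_frame_swap_second_third:
  assumes "proj_frame x M a i j l m k"
  shows "proj_frame x (M ** vector [vector [1, 0, 0], vector [0, 0, 1], vector [0, 1, 0]])
    (vector [a$1, a$3, a$2]) i l j m k" (is "proj_frame x (M ** ?T) ?a i l j m k")
proof -
  note F = assms[unfolded proj_frame_def]
  have T: "(M ** ?T) *v v = M *v vector [v$1, v$3, v$2]" for v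
    unfolding matrix_vector_mul_assoc[symmetric]
    by (rule arg_cong[where f = "\<lambda>w. M *v w"])
      (simp add: complex_vec3_eq_iff matrix_vector_mult_def sum_3 vector_3)
  have "invertible ?T"
    by (intro invertible_ker) (auto simp: complex_vec3_eq_iff matrix_vector_mult_def sum_3 vector_3)
  then have "invertible (M ** ?T)" using F invertible_mult by blast
  moreover have "vector [a$1, a$2, a$3] = a"
    by (simp_all add: complex_vec3_eq_iff vector_3)
  moreover have "UNIV = {i, l, j, m, k}" "distinct [i, l, j, m, k]" using F by auto
  ultimately show ?thesis
    unfolding proj_frame_def T using F by (auto simp: vector_3)
qed

section \<open>The rank condition in coordinates\<close>

definition kron_dependent :: "('r::finite \<Rightarrow> complex^3) \<Rightarrow> ('r \<Rightarrow> complex^3) \<Rightarrow> bool" where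
  "kron_dependent U V \<longleftrightarrow>
     (\<exists>c. (\<exists>r. c r \<noteq> 0) \<and> (\<forall>p q. (\<Sum>r\<in>UNIV. c r * U r $ p * V r $ q) = 0))"

text \<open>
  The rank counts the dimension of the set of rows, so equal rows need care: they are a
  dependence of the family even if the set is independent.
\<close>

lemma rank_less_iff:
  fixes A :: "'a::field^'n^'r"
  shows "rank A < CARD('r) \<longleftrightarrow> (\<exists>c. (\<exists>r. c r \<noteq> 0) \<and> (\<Sum>r\<in>UNIV. c r *s row r A) = 0)"
proof (rule iffI)
  have rows: "rows A = range (\<lambda>r. row r A)" by (auto simp: rows_def)
  have fin: "finite (rows A)" unfolding rows by simp
  have full: "rank A = CARD('r)"
    if no: "\<not> (\<exists>c. (\<exists>r. c r \<noteq> 0) \<and> (\<Sum>r\<in>UNIV. c r *s row r A) = 0)"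
  proof -
    have inj: "inj (\<lambda>r. row r A)"
    proof (rule injI, rule ccontr)
      fix r s assume rs: "row r A = row s A" "r \<noteq> s"
      define c :: "'r \<Rightarrow> 'a" where "c = (\<lambda>n. if n = r then 1 else if n = s then -1 else 0)"
      have "(\<Sum>n\<in>UNIV. c n *s row n A) = (\<Sum>n\<in>{r, s}. c n *s row n A)"
        by (rule sum.mono_neutral_right) (auto simp: c_def)
      also have "\<dots> = 0" using rs by (simp add: c_def)
      finally have "(\<Sum>n\<in>UNIV. c n *s row n A) = 0" .
      moreover have "c r \<noteq> 0" by (simp add: c_def)
      ultimately show False using no by blast
    qed
    have "\<not> vec.dependent (rows A)"
    proof
      assume "vec.dependent (rows A)"
      then obtain f where f: "\<exists>v\<in>rows A. f v \<noteq> 0" "(\<Sum>v\<in>rows A. f v *s v) = 0"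
        using vec.dependent_finite[OF fin] by blast
      have "(\<Sum>r\<in>UNIV. f (row r A) *s row r A) = 0"
        using f(2) unfolding rows sum.reindex[OF inj] by simp
      moreover have "\<exists>r. f (row r A) \<noteq> 0" using f(1) rows by auto
      ultimately have "\<exists>c. (\<exists>r. c r \<noteq> 0) \<and> (\<Sum>r\<in>UNIV. c r *s row r A) = 0"
        by (intro exI[of _ "\<lambda>r. f (row r A)"] conjI)
      then show False using no by contradiction
    qed
    then show ?thesis
      by (simp add: row_rank_def_gen vec.dim_eq_card_independent) (simp add: rows card_image[OF inj])
  qed
  show "\<exists>c. (\<exists>r. c r \<noteq> 0) \<and> (\<Sum>r\<in>UNIV. c r *s row r A) = 0" if "rank A < CARD('r)"
  proof (rule ccontr)
    assume "\<not> ?thesis"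
    from full[OF this] that show False by simp
  qed
  assume "\<exists>c. (\<exists>r. c r \<noteq> 0) \<and> (\<Sum>r\<in>UNIV. c r *s row r A) = 0"
  then obtain c r where c: "c r \<noteq> 0" "(\<Sum>r\<in>UNIV. c r *s row r A) = 0" by blast
  have "c r *s row r A = - (\<Sum>n\<in>UNIV - {r}. c n *s row n A)"
    using c(2) by (simp add: sum.remove[of UNIV r] eq_neg_iff_add_eq_0)
  then have "inverse (c r) *s (c r *s row r A) = inverse (c r) *s - (\<Sum>n\<in>UNIV - {r}. c n *s row n A)"
    by simp
  then have "row r A = inverse (c r) *s - (\<Sum>n\<in>UNIV - {r}. c n *s row n A)"
    using c(1) by (simp add: vector_smult_assoc)
  also have "\<dots> \<in> vec.span ((\<lambda>n. row n A) ` (UNIV - {r}))"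
    by (intro vec.span_scale vec.span_neg vec.span_sum vec.span_base) auto
  finally have r: "row r A \<in> vec.span ((\<lambda>n. row n A) ` (UNIV - {r}))" .
  have "rows A \<subseteq> vec.span ((\<lambda>n. row n A) ` (UNIV - {r}))"
  proof
    fix v assume "v \<in> rows A"
    then obtain n where "v = row n A" using rows by auto
    then show "v \<in> vec.span ((\<lambda>n. row n A) ` (UNIV - {r}))"
      using r by (cases "n = r") (auto intro: vec.span_base)
  qed
  then have "rank A \<le> card ((\<lambda>n. row n A) ` (UNIV - {r}))"
    unfolding row_rank_def_gen by (intro vec.dim_le_card) auto
  also have "\<dots> \<le> card (UNIV - {r})" by (intro card_image_le) auto
  also have "\<dots> < CARD('r)" by (rule psubset_card_mono) auto
  finally show "rank A < CARD('r)" .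
qed

lemma kron_dependent_transform:
  assumes "kron_dependent U V" and nz: "\<And>r. \<alpha> r \<noteq> 0" "\<And>r. \<beta> r \<noteq> 0"
  shows "kron_dependent (\<lambda>r. \<alpha> r *s (A *v U r)) (\<lambda>r. \<beta> r *s (B *v V r))"
proof -
  obtain c where c: "\<exists>r. c r \<noteq> 0" "\<And>p q. (\<Sum>r\<in>UNIV. c r * U r $ p * V r $ q) = 0"
    using assms(1) unfolding kron_dependent_def by blast
  define d where "d r = c r / (\<alpha> r * \<beta> r)" for r
  have "(\<Sum>r\<in>UNIV. d r * (\<alpha> r *s (A *v U r)) $ p * (\<beta> r *s (B *v V r)) $ q) = 0" for p q
  proof -
    have "(\<Sum>r\<in>UNIV. d r * (\<alpha> r *s (A *v U r)) $ p * (\<beta> r *s (B *v V r)) $ q)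
        = (\<Sum>r\<in>UNIV. c r * (A *v U r) $ p * (B *v V r) $ q)"
      using nz by (intro sum.cong) (simp_all add: d_def)
    also have "\<dots> = (\<Sum>g\<in>UNIV. \<Sum>h\<in>UNIV. A $ p $ g * B $ q $ h *
        (\<Sum>r\<in>UNIV. c r * U r $ g * V r $ h))"
      by (simp add: matrix_vector_mult_def sum_3 sum_distrib_left sum.distrib[symmetric] algebra_simps)
    finally show ?thesis by (simp add: c(2))
  qed
  moreover have "\<exists>r. d r \<noteq> 0" using c(1) nz by (simp add: d_def)
  ultimately show ?thesis unfolding kron_dependent_def by blast
qed

lemma rank_Z6_iff_kron_dependent:
  "rank (Z6 x y u v) < 6 \<longleftrightarrow> kron_dependent
     (\<lambda>r. rep_proj_plane (case r of Some n \<Rightarrow> x n | None \<Rightarrow> u))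
     (\<lambda>r. rep_proj_plane (case r of Some n \<Rightarrow> y n | None \<Rightarrow> v))"
proof -
  have row: "row r (Z6 x y u v) $ (p, q) = rep_proj_plane (case r of Some n \<Rightarrow> x n | None \<Rightarrow> u) $ p *
     rep_proj_plane (case r of Some n \<Rightarrow> y n | None \<Rightarrow> v) $ q" for r p q
    by (simp add: row_def Z6_def kron_def split: option.split)
  have "CARD(5 option) = 6" by simp
  then show ?thesis
    using rank_less_iff[of "Z6 x y u v"]
    by (simp add: kron_dependent_def vec_eq_iff row mult.assoc)
qed

text \<open>
  The three rank-one matrices that belong to \<open>e1, e2, e3\<close> can adjust the diagonal freely, so
  only the entries off the diagonal constrain \<open>u\<close> and \<open>v\<close>. The first five rows admit no
  dependence among themselves because the off-diagonal entries of \<open>a b\<^sup>T\<close> are not all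
  equal; this makes the coefficient of the sixth row nonzero.
\<close>

lemma kron_dependent_frame:
  fixes U V :: "5 option \<Rightarrow> complex^3"
  assumes d: "distinct [i, j, l, m, k]" and UN: "UNIV = {i, j, l, m, k}"
    and U: "U (Some i) = vector [1,0,0]" "U (Some j) = vector [0,1,0]" "U (Some l) = vector [0,0,1]"
      "U (Some m) = vector [1,1,1]" "U (Some k) = a" "U None = u"
    and V: "V (Some i) = vector [1,0,0]" "V (Some j) = vector [0,1,0]" "V (Some l) = vector [0,0,1]"
      "V (Some m) = vector [1,1,1]" "V (Some k) = b" "V None = v"
    and ab: "a $ 1 \<noteq> 0" "b $ 2 \<noteq> b $ 3"
  shows "kron_dependent U V \<longleftrightarrow> (\<exists>s t. \<forall>p q. p \<noteq> q \<longrightarrow> u $ p * v $ q = s + t * a $ p * b $ q)"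
proof -
  have UO: "(UNIV :: 5 option set) = {None, Some i, Some j, Some l, Some m, Some k}"
    unfolding UNIV_option_conv UN by auto
  have sum: "(\<Sum>r\<in>UNIV. f r) = f None + f (Some i) + f (Some j) + f (Some l) + f (Some m) + f (Some k)"
    for f :: "5 option \<Rightarrow> complex"
    unfolding UO using d by (simp add: add.assoc)
  show ?thesis
  proof
    assume "kron_dependent U V"
    then obtain c where c: "\<exists>r. c r \<noteq> 0" and 0: "\<And>p q. (\<Sum>r\<in>UNIV. c r * U r $ p * V r $ q) = 0"
      unfolding kron_dependent_def by blast
    have off: "c None * (u $ p * v $ q) + c (Some m) + c (Some k) * a $ p * b $ q = 0" if "p \<noteq> q" for p q
      using 0[of p q] that exhaust_3[of p] exhaust_3[of q]
      by (auto simp: sum U V vector_3 mult.assoc)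
    have "c None \<noteq> 0"
    proof
      assume n: "c None = 0"
      have "c (Some k) * (a $ 1 * (b $ 2 - b $ 3)) = 0"
        using off[of 1 2] off[of 1 3] unfolding n by simp algebra
      then have k: "c (Some k) = 0" using ab by simp
      then have m: "c (Some m) = 0" using off[of 1 2] by (simp add: n)
      have "c (Some i) = 0" "c (Some j) = 0" "c (Some l) = 0"
        using 0[of 1 1] 0[of 2 2] 0[of 3 3] by (simp_all add: sum U V n m k vector_3)
      then have "\<forall>r\<in>UNIV. c r = 0" unfolding UO using n m k by simp
      then show False using c by simp
    qed
    then have "u $ p * v $ q = - c (Some m) / c None + - c (Some k) / c None * a $ p * b $ q"
      if "p \<noteq> q" for p q
      using off[OF that] \<open>c None \<noteq> 0\<close> by (simp add: field_simps) algebra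
    then show "\<exists>s t. \<forall>p q. p \<noteq> q \<longrightarrow> u $ p * v $ q = s + t * a $ p * b $ q" by blast
  next
    assume "\<exists>s t. \<forall>p q. p \<noteq> q \<longrightarrow> u $ p * v $ q = s + t * a $ p * b $ q"
    then obtain s t where st: "\<And>p q. p \<noteq> q \<Longrightarrow> u $ p * v $ q = s + t * a $ p * b $ q" by blast
    \<comment> \<open>what is missing on the diagonal\<close>
    define D where "D p = s + t * a $ p * b $ p - u $ p * v $ p" for p
    define c where "c r = (case r of None \<Rightarrow> 1 | Some n \<Rightarrow> if n = i then D 1 else if n = j then D 2
      else if n = l then D 3 else if n = m then - s else - t)" for r
    have "(\<Sum>r\<in>UNIV. c r * U r $ p * V r $ q) = 0" for p q
    proof (cases "p = q")
      case True
      then show ?thesis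
        using exhaust_3[of p] d by (auto simp: sum c_def U V vector_3 D_def)
    next
      case False
      then show ?thesis
        using st[OF False] exhaust_3[of p] exhaust_3[of q] d
        by (auto simp: sum c_def U V vector_3 D_def)
    qed
    moreover have "c None \<noteq> 0" by (simp add: c_def)
    ultimately show "kron_dependent U V" unfolding kron_dependent_def by blast
  qed
qed

lemma rank_Z6_less_iff:
  assumes X: "proj_frame x M a i j l m k" and Y: "proj_frame y N b i j l m k"
    and u: "u \<noteq> 0" and v: "v \<noteq> 0"
  shows "rank (Z6 x y (pt (M *v u)) (pt (N *v v))) < 6 \<longleftrightarrow>
    (\<exists>s t. \<forall>p q. p \<noteq> q \<longrightarrow> u $ p * v $ q = s + t * a $ p * b $ q)"
proof -
  have d: "distinct [i, j, l, m, k]" and UN: "UNIV = {i, j, l, m, k}"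
    using X by (simp_all add: proj_frame_def)
  have reps: "\<exists>U \<alpha>. (U (Some i) = vector [1,0,0] \<and> U (Some j) = vector [0,1,0] \<and>
      U (Some l) = vector [0,0,1] \<and> U (Some m) = vector [1,1,1] \<and> U (Some k) = c \<and> U None = w) \<and>
      (\<forall>r. \<alpha> r \<noteq> 0 \<and> rep_proj_plane (case r of Some n \<Rightarrow> z n | None \<Rightarrow> pt (L *v w)) = \<alpha> r *s (L *v U r))"
    if Z: "proj_frame z L c i j l m k" and w: "w \<noteq> 0" for z L c w
  proof -
    define U where "U r = (case r of None \<Rightarrow> w | Some n \<Rightarrow> if n = i then vector [1,0,0]
      else if n = j then vector [0,1,0] else if n = l then vector [0,0,1]
      else if n = m then vector [1,1,1] else c)" for r
    have L: "invertible L" using Z by (simp add: proj_frame_def)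
    have Unz: "U r \<noteq> 0" for r
      using Z w by (auto simp: U_def proj_frame_def proj_frame_vectors_nonzero split: option.split)
    have eq: "(case r of Some n \<Rightarrow> z n | None \<Rightarrow> pt (L *v w)) = pt (L *v U r)" for r
    proof (cases r)
      case (Some n)
      have "n \<in> {i, j, l, m, k}" using UN by blast
      then show ?thesis using Z Some by (auto simp: U_def proj_frame_def)
    qed (simp add: U_def)
    have "\<forall>r. \<exists>\<alpha>. \<alpha> \<noteq> 0 \<and> rep_proj_plane (case r of Some n \<Rightarrow> z n | None \<Rightarrow> pt (L *v w)) = \<alpha> *s (L *v U r)"
    proof
      fix r
      have "L *v U r \<noteq> 0" using Unz L by (simp add: invertible_mult_eq_0_iff)
      then show "\<exists>\<alpha>. \<alpha> \<noteq> 0 \<and> rep_proj_plane (case r of Some n \<Rightarrow> z n | None \<Rightarrow> pt (L *v w)) = \<alpha> *s (L *v U r)"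
        unfolding eq using rep_pt by blast
    qed
    then obtain \<alpha> where "\<forall>r. \<alpha> r \<noteq> 0 \<and> rep_proj_plane (case r of Some n \<Rightarrow> z n | None \<Rightarrow> pt (L *v w)) = \<alpha> r *s (L *v U r)"
      by metis
    then show ?thesis using d by (intro exI[of _ U] exI[of _ \<alpha>]) (auto simp: U_def)
  qed
  obtain U \<alpha> where U: "U (Some i) = vector [1,0,0]" "U (Some j) = vector [0,1,0]"
      "U (Some l) = vector [0,0,1]" "U (Some m) = vector [1,1,1]" "U (Some k) = a" "U None = u"
    and \<alpha>: "\<And>r. \<alpha> r \<noteq> 0"
      "\<And>r. rep_proj_plane (case r of Some n \<Rightarrow> x n | None \<Rightarrow> pt (M *v u)) = \<alpha> r *s (M *v U r)"
    using reps[OF X u] by blast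
  obtain V \<beta> where V: "V (Some i) = vector [1,0,0]" "V (Some j) = vector [0,1,0]"
      "V (Some l) = vector [0,0,1]" "V (Some m) = vector [1,1,1]" "V (Some k) = b" "V None = v"
    and \<beta>: "\<And>r. \<beta> r \<noteq> 0"
      "\<And>r. rep_proj_plane (case r of Some n \<Rightarrow> y n | None \<Rightarrow> pt (N *v v)) = \<beta> r *s (N *v V r)"
    using reps[OF Y v] by blast
  have M: "invertible M" "invertible N" using X Y by (simp_all add: proj_frame_def)
  have "kron_dependent (\<lambda>r. \<alpha> r *s (M *v U r)) (\<lambda>r. \<beta> r *s (N *v V r)) \<longleftrightarrow> kron_dependent U V"
  proof
    assume "kron_dependent (\<lambda>r. \<alpha> r *s (M *v U r)) (\<lambda>r. \<beta> r *s (N *v V r))"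
    from kron_dependent_transform[OF this, of "\<lambda>r. inverse (\<alpha> r)" "\<lambda>r. inverse (\<beta> r)" "matrix_inv M" "matrix_inv N"]
    show "kron_dependent U V"
      using \<alpha>(1) \<beta>(1) M by (simp add: vector_scalar_commute invertible_inverse_mult vector_smult_assoc)
  next
    assume "kron_dependent U V"
    then show "kron_dependent (\<lambda>r. \<alpha> r *s (M *v U r)) (\<lambda>r. \<beta> r *s (N *v V r))"
      using \<alpha>(1) \<beta>(1) by (rule kron_dependent_transform)
  qed
  moreover have "a $ 1 \<noteq> 0" "b $ 2 \<noteq> b $ 3" using X Y by (simp_all add: proj_frame_def)
  ultimately show ?thesis
    unfolding rank_Z6_iff_kron_dependent \<alpha>(2) \<beta>(2)
    using kron_dependent_frame[of i j l m k U a u V b v] d UN U V by simp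
qed

section \<open>The points y k and the conics C'\<close>

abbreviation image_conic :: "('i \<Rightarrow> proj_plane) \<Rightarrow> ('i \<Rightarrow> proj_plane) \<Rightarrow> 'i \<Rightarrow> proj_plane set" where
  "image_conic x y k \<equiv> homography_except x y k ` conic_through x"

text \<open>
  The conic \<open>C'\<close> for the index \<open>m\<close> of the unit point, in the coordinates of the frame that
  omits \<open>k\<close>: it passes through \<open>e1, e2, e3, b\<close> and, since the homography that omits \<open>m\<close> is
  diagonal with entries \<open>b$p / a$p\<close>, through the image \<open>(b$1 / a$1, b$2 / a$2, b$3 / a$3)\<close>
  of the unit point.
\<close>

definition unit_conic_form :: "complex^3 \<Rightarrow> complex^3 \<Rightarrow> complex^3 \<Rightarrow> complex" where
  "unit_conic_form a b v = b$1 * (a$2 - a$3) * v$2 * v$3 + b$2 * (a$3 - a$1) * v$1 * v$3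
     + b$3 * (a$1 - a$2) * v$1 * v$2"

text \<open>
  After \<open>m\<close> and \<open>k\<close> are exchanged the points \<open>x m\<close> and \<open>y m\<close> have the reciprocals of \<open>a\<close> and
  \<open>b\<close> as coordinates, and the form of \<open>C'\<close> for \<open>m\<close> is a \<open>conic_form\<close> again; clearing
  denominators gives \<open>unit_conic_form\<close>.
\<close>

lemma mem_image_conic_fourth:
  assumes X: "proj_frame x M a i j l m k" and Y: "proj_frame y N b i j l m k" and v: "v \<noteq> 0"
  shows "pt (N *v v) \<in> image_conic x y m \<longleftrightarrow> unit_conic_form a b v = 0"
proof -
  define T where "T = (vector [vector [b$1, 0, 0], vector [0, b$2, 0], vector [0, 0, b$3]] :: complex^3^3)"
  define w where "w = (vector [v$1 / b$1, v$2 / b$2, v$3 / b$3] :: complex^3)"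
  have a: "a$1 \<noteq> 0" "a$2 \<noteq> 0" "a$3 \<noteq> 0" and b: "b$1 \<noteq> 0" "b$2 \<noteq> 0" "b$3 \<noteq> 0"
    using X Y by (simp_all add: proj_frame_def)
  have "T *v w = v"
    using b by (simp add: T_def w_def complex_vec3_eq_iff matrix_vector_mult_def sum_3 vector_3)
  then have "(N ** T) *v w = N *v v" by (simp flip: matrix_vector_mul_assoc)
  moreover have "w \<noteq> 0" using v b by (auto simp: w_def complex_vec3_eq_iff vector_3)
  ultimately have "pt (N *v v) \<in> image_conic x y m \<longleftrightarrow>
      conic_form (vector [1 / a$1, 1 / a$2, 1 / a$3]) w = 0"
    using mem_image_conic[OF proj_frame_swap_last[OF X] proj_frame_swap_last[OF Y]] T_def by metis
  moreover have "conic_form (vector [1 / a$1, 1 / a$2, 1 / a$3]) w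
      * (a$1 * a$2 * a$3 * b$1 * b$2 * b$3) = - unit_conic_form a b v"
    using a b by (simp add: conic_form_def unit_conic_form_def w_def vector_3 field_simps)
  ultimately show ?thesis using a b
    by (metis mult_eq_0_iff neg_equal_0_iff_equal)
qed

text \<open>
  The next five lemmas express, in one fixed frame, when the point \<open>y n\<close> that \<open>C'\<close> for the
  index \<open>n\<close> is not required to contain lies on it nevertheless. Each condition says that the
  four other pairs look alike from \<open>x n\<close> and \<open>y n\<close>: the pencils of lines through these
  points have equal cross-ratios.
\<close>

lemma own_point_last:
  assumes X: "proj_frame x M a i j l m k" and Y: "proj_frame y N b i j l m k"
  shows "y k \<in> image_conic x y k \<longleftrightarrow> conic_form a b = 0"
  using mem_image_conic[OF X Y, of b] Y by (auto simp: proj_frame_def proj_frame_vectors_nonzero)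

lemma own_point_fourth:
  assumes X: "proj_frame x M a i j l m k" and Y: "proj_frame y N b i j l m k"
  shows "y m \<in> image_conic x y m \<longleftrightarrow> unit_conic_form a b (vector [1, 1, 1]) = 0"
  using mem_image_conic_fourth[OF X Y, of "vector [1,1,1]"] Y
  by (auto simp: proj_frame_def proj_frame_vectors_nonzero)

lemma own_point_third:
  assumes X: "proj_frame x M a i j l m k" and Y: "proj_frame y N b i j l m k"
  shows "y l \<in> image_conic x y l \<longleftrightarrow> a$1 * b$2 = a$2 * b$1"
  unfolding own_point_fourth[OF proj_frame_swap_third_fourth[OF X] proj_frame_swap_third_fourth[OF Y]]
  by (auto simp: unit_conic_form_def vector_3 algebra_simps)

lemma own_point_first:
  assumes X: "proj_frame x M a i j l m k" and Y: "proj_frame y N b i j l m k"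
  shows "y i \<in> image_conic x y i \<longleftrightarrow> a$2 * b$3 = a$3 * b$2"
  using own_point_third[OF proj_frame_swap_first_third[OF X] proj_frame_swap_first_third[OF Y]]
  by (auto simp: vector_3)

lemma own_point_second:
  assumes X: "proj_frame x M a i j l m k" and Y: "proj_frame y N b i j l m k"
  shows "y j \<in> image_conic x y j \<longleftrightarrow> a$1 * b$3 = a$3 * b$1"
  using own_point_third[OF proj_frame_swap_second_third[OF X] proj_frame_swap_second_third[OF Y]]
  by (simp add: vector_3)

lemma mem_image_conic_other:
  assumes X: "proj_frame x M a i j l m k" and Y: "proj_frame y N b i j l m k" and n: "n \<noteq> k"
  shows "y n \<in> image_conic x y k"
proof -
  have "n \<in> {i, j, l, m}" using X n by (auto simp: proj_frame_def)
  moreover have "y i = pt (N *v vector [1, 0, 0])" "y j = pt (N *v vector [0, 1, 0])"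
     "y l = pt (N *v vector [0, 0, 1])" "y m = pt (N *v vector [1, 1, 1])"
    using Y by (simp_all add: proj_frame_def)
  moreover note mem_image_conic[OF X Y] proj_frame_vectors_nonzero
  ultimately show ?thesis
    by (auto simp: conic_form_def vector_3 algebra_simps)
qed

section \<open>Rank-deficient new pairs\<close>

text \<open>
  Inverse homographies exchange the roles of the two point families.
\<close>

lemma pairs_general_position_sym:
  assumes "pairs_general_position x y"
  shows "pairs_general_position y x"
proof -
  have "card {i. f (y i) = x i} \<le> 4" if f: "is_homography f" for f
  proof -
    obtain A where A: "invertible A" "\<And>v. v \<noteq> 0 \<Longrightarrow> f (pt v) = pt (A *v v)"
      using homography_pt[OF f] by blast
    have "invertible (mat 1 :: complex^3^3)"
      using invertible_def matrix_mul_lid by blast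
    then obtain g where g: "is_homography g" "\<And>v. v \<noteq> 0 \<Longrightarrow> g (pt (A *v v)) = pt v"
      using homography_between_coordinates[OF A(1)] by (metis matrix_vector_mul_lid)
    have "g (f p) = p" for p
      using A(2)[OF rep_nonzero[of p]] g(2)[OF rep_nonzero[of p]] by (simp add: pt_rep)
    then have "{i. f (y i) = x i} \<subseteq> {i. g (x i) = y i}" by auto (metis)
    then have "card {i. f (y i) = x i} \<le> card {i. g (x i) = y i}" by (intro card_mono) auto
    also have "\<dots> \<le> 4" using assms g(1) by (simp add: pairs_general_position_def)
    finally show ?thesis .
  qed
  then show ?thesis using assms by (simp add: pairs_general_position_def)
qed

text \<open>
  If \<open>a\<close> and \<open>b\<close> represented the same point, the homography that is the identity on
  coordinates would match all five pairs.
\<close>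

lemma last_coordinates_not_proportional:
  fixes x y :: "5 \<Rightarrow> proj_plane"
  assumes X: "proj_frame x M a i j l m k" and Y: "proj_frame y N b i j l m k"
    and gp: "pairs_general_position x y"
  shows "b \<noteq> c *s a"
proof
  assume b: "b = c *s a"
  have M: "invertible M" "invertible N" and UN: "UNIV = {i, j, l, m, k}"
    and nz: "a \<noteq> 0" "b \<noteq> 0"
    using X Y by (auto simp: proj_frame_def proj_frame_vectors_nonzero)
  obtain f where f: "is_homography f" "\<And>v. v \<noteq> 0 \<Longrightarrow> f (pt (M *v v)) = pt (N *v v)"
    using homography_between_coordinates[OF M] by blast
  have "c \<noteq> 0" using b nz(2) by auto
  then have "pt (N *v a) = pt (N *v b)" using pt_mult_eq_iff[OF M(2) nz] b by blast
  then have "f (x i) = y i" "f (x j) = y j" "f (x l) = y l" "f (x m) = y m" "f (x k) = y k"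
    using X Y nz f(2) by (simp_all add: proj_frame_def proj_frame_vectors_nonzero)
  then have "\<forall>n\<in>UNIV. f (x n) = y n" unfolding UN by blast
  then have "{n. f (x n) = y n} = UNIV" by blast
  moreover have "card {n. f (x n) = y n} \<le> 4"
    using gp f(1) by (simp add: pairs_general_position_def)
  ultimately show False by simp
qed

text \<open>
  The second equation says that \<open>(1, 1, 1)\<close>, \<open>a\<close>, \<open>b\<close> are linearly dependent, so
  \<open>b = \<alpha> + \<beta> a\<close> entrywise. Then \<open>conic_form a b\<close> has no \<open>\<alpha>\<^sup>2\<close> and
  no \<open>\<beta>\<^sup>2\<close> term, since it vanishes at \<open>(1, 1, 1)\<close> and at \<open>a\<close>; what remains is
  \<open>\<alpha> \<beta>\<close> times a Vandermonde determinant.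
\<close>

lemma forms_vanish_imp_proportional:
  assumes "conic_form a b = 0" "unit_conic_form a b (vector [1, 1, 1]) = 0"
    and a: "a$1 \<noteq> a$2" "a$1 \<noteq> a$3" "a$2 \<noteq> a$3" and b: "b$1 \<noteq> b$2"
  obtains c where "b = c *s a"
proof -
  define \<beta> where "\<beta> = (b$2 - b$1) / (a$2 - a$1)"
  define \<alpha> where "\<alpha> = b$1 - \<beta> * a$1"
  have b1: "b$1 = \<alpha> + \<beta> * a$1" by (simp add: \<alpha>_def)
  have \<beta>: "\<beta> * (a$2 - a$1) = b$2 - b$1" using a by (simp add: \<beta>_def)
  have b2: "b$2 = \<alpha> + \<beta> * a$2" using b1 \<beta> by algebra
  have "(b$3 - \<alpha> - \<beta> * a$3) * (a$1 - a$2) = 0"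
    using assms(2) unfolding unit_conic_form_def vector_3 b1 b2 by algebra
  then have "b$3 - \<alpha> - \<beta> * a$3 = 0" using a by (simp only: mult_eq_0_iff) simp
  then have b3: "b$3 = \<alpha> + \<beta> * a$3" by algebra
  have "\<alpha> * \<beta> * ((a$1 - a$2) * (a$1 - a$3) * (a$2 - a$3)) = 0"
    using assms(1) unfolding conic_form_def b1 b2 b3 by algebra
  moreover have "\<beta> \<noteq> 0" using a b by (simp add: \<beta>_def)
  ultimately have "\<alpha> = 0" using a by simp
  then have "b = \<beta> *s a" by (simp add: complex_vec3_eq_iff b1 b2 b3)
  then show thesis by (rule that)
qed

lemma proportional_off_diagonal:
  assumes off: "\<And>p q. p \<noteq> q \<Longrightarrow> u $ p * v $ q = t * a $ p * b $ q" and t: "t \<noteq> 0"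
    and a: "a$1 \<noteq> 0" "a$2 \<noteq> 0" "a$3 \<noteq> 0" and b: "b$1 \<noteq> 0" "b$2 \<noteq> 0" "b$3 \<noteq> 0"
  obtains c d where "c \<noteq> 0" "d \<noteq> 0" "u = c *s a" "v = d *s (b :: complex^3)"
proof -
  have 12: "u$1 * v$2 = t * a$1 * b$2" and 13: "u$1 * v$3 = t * a$1 * b$3"
   and 21: "u$2 * v$1 = t * a$2 * b$1" and 23: "u$2 * v$3 = t * a$2 * b$3"
   and 31: "u$3 * v$1 = t * a$3 * b$1" and 32: "u$3 * v$2 = t * a$3 * b$2"
    using off by auto
  have nz: "u$1 \<noteq> 0" "v$1 \<noteq> 0" "v$2 \<noteq> 0" "v$3 \<noteq> 0" "u$2 \<noteq> 0" "u$3 \<noteq> 0"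
    using 12 13 21 31 t a b by auto
  have e: "(u$2 * a$1 - u$1 * a$2) * v$3 = 0" "(u$3 * a$1 - u$1 * a$3) * v$2 = 0"
    "u$3 * (v$2 * b$1 - v$1 * b$2) = 0" "u$2 * (v$3 * b$1 - v$1 * b$3) = 0"
    using 12 13 21 23 31 32 by algebra+
  have "u = (u$1 / a$1) *s a" "v = (v$1 / b$1) *s b"
    using e nz a b by (simp_all add: complex_vec3_eq_iff field_simps)
  then show thesis using nz a b by (intro that[of "u$1 / a$1" "v$1 / b$1"]) auto
qed

lemma vanishing_off_diagonal:
  fixes u v :: "complex^3"
  assumes off: "\<And>p q. p \<noteq> q \<Longrightarrow> u $ p * v $ q = 0" and nz: "u \<noteq> 0" "v \<noteq> 0"
  obtains e c d where "e \<in> {vector [1,0,0], vector [0,1,0], vector [0,0,1]}"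
    "c \<noteq> 0" "d \<noteq> 0" "u = c *s e" "v = d *s e"
proof -
  have off: "u$1 * v$2 = 0" "u$1 * v$3 = 0" "u$2 * v$1 = 0" "u$2 * v$3 = 0" "u$3 * v$1 = 0" "u$3 * v$2 = 0"
    using off by auto
  consider "u$1 \<noteq> 0" | "u$2 \<noteq> 0" | "u$3 \<noteq> 0" using nz by (auto simp: complex_vec3_eq_iff)
  then show thesis
  proof cases
    case 1
    with off nz show thesis
      by (intro that[of "vector [1,0,0]" "u$1" "v$1"]) (auto simp: complex_vec3_eq_iff vector_3)
  next
    case 2
    with off nz show thesis
      by (intro that[of "vector [0,1,0]" "u$2" "v$2"]) (auto simp: complex_vec3_eq_iff vector_3)
  next
    case 3
    with off nz show thesis
      by (intro that[of "vector [0,0,1]" "u$3" "v$3"]) (auto simp: complex_vec3_eq_iff vector_3)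
  qed
qed

text \<open>
  If both coefficients vanish the solution is one of the pairs \<open>(e p, e p)\<close>. If exactly one
  does, the off-diagonal entries of \<open>u v\<^sup>T\<close> are proportional to those of \<open>a b\<^sup>T\<close>
  or of the all-one matrix, and they determine \<open>u\<close> and \<open>v\<close> up to scale.
\<close>

lemma new_pair_coefficients_nonzero:
  assumes X: "proj_frame x M a i j l m k" and Y: "proj_frame y N b i j l m k"
    and nz: "u \<noteq> 0" "v \<noteq> 0" and new: "is_new_pair x y (pt (M *v u)) (pt (N *v v))"
    and off: "\<And>p q. p \<noteq> q \<Longrightarrow> u $ p * v $ q = s + t * a $ p * b $ q"
  shows "s \<noteq> 0" "t \<noteq> 0"
proof -
  have M: "invertible M" "invertible N" and ab: "a$1 \<noteq> 0" "a$2 \<noteq> 0" "a$3 \<noteq> 0"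
      "b$1 \<noteq> 0" "b$2 \<noteq> 0" "b$3 \<noteq> 0"
    using X Y by (auto simp: proj_frame_def)
  have no: False if "x n = pt (M *v e)" "y n = pt (N *v f)" "c \<noteq> 0" "d \<noteq> 0" "u = c *s e" "v = d *s f"
    for n e f c d
  proof -
    have "e \<noteq> 0" "f \<noteq> 0" using nz that by auto
    then have "pt (M *v u) = x n" "pt (N *v v) = y n"
      using that M by (simp_all add: pt_mult_scale)
    then show False using new unfolding is_new_pair_def by metis
  qed
  note x = X[unfolded proj_frame_def] and y = Y[unfolded proj_frame_def]
  have "\<not> (s = 0 \<and> t = 0)"
  proof
    assume "s = 0 \<and> t = 0"
    then obtain e c d where "e \<in> {vector [1,0,0], vector [0,1,0], vector [0,0,1]}"
        "c \<noteq> 0" "d \<noteq> 0" "u = c *s e" "v = d *s e"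
      using vanishing_off_diagonal[OF _ nz] off by (metis add_0 mult_zero_left)
    then show False using no[of i e e c d] no[of j e e c d] no[of l e e c d] x y by auto
  qed
  moreover have "\<not> (s = 0 \<and> t \<noteq> 0)"
  proof
    assume st: "s = 0 \<and> t \<noteq> 0"
    then have off': "u $ p * v $ q = t * a $ p * b $ q" if "p \<noteq> q" for p q using off[OF that] by simp
    from st have "t \<noteq> 0" by simp
    obtain c d where "c \<noteq> 0" "d \<noteq> 0" "u = c *s a" "v = d *s b"
      by (rule proportional_off_diagonal[OF off' \<open>t \<noteq> 0\<close> ab])
    then show False using no[of k a b c d] x y by blast
  qed
  moreover have "\<not> (s \<noteq> 0 \<and> t = 0)"
  proof
    assume st: "s \<noteq> 0 \<and> t = 0"
    have one: "(vector [1,1,1] :: complex^3) $ p = 1" for p using exhaust_3[of p] by (auto simp: vector_3)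
    have off': "u $ p * v $ q = s * (vector [1,1,1] :: complex^3) $ p * (vector [1,1,1] :: complex^3) $ q"
      if "p \<noteq> q" for p q using off[OF that] st by (simp add: one)
    obtain c d where "c \<noteq> 0" "d \<noteq> 0" "u = c *s vector [1,1,1]" "v = d *s vector [1,1,1]"
      by (rule proportional_off_diagonal[OF off']) (use st in \<open>simp_all add: one\<close>)
    then show False using no[of m "vector [1,1,1]" "vector [1,1,1]" c d] x y by blast
  qed
  ultimately show "s \<noteq> 0" "t \<noteq> 0" by auto
qed

text \<open>
  The two cyclic products of off-diagonal entries agree on a matrix of rank one. For the
  entries \<open>s + t * a$p * b$q\<close> their difference splits off \<open>s * t\<close>, and the two conic forms
  appear as the coefficients of the linear rest.
\<close>

lemma cyclic_product_identity:
  fixes s t :: complex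
  shows "(s + t * a$1 * b$2) * (s + t * a$2 * b$3) * (s + t * a$3 * b$1)
    - (s + t * a$2 * b$1) * (s + t * a$3 * b$2) * (s + t * a$1 * b$3)
    = s * t * (t * conic_form a b - s * unit_conic_form a b (vector [1, 1, 1]))"
  by (simp add: conic_form_def unit_conic_form_def vector_3 algebra_simps)

text \<open>
  For the first claim, eliminating \<open>t\<close> from the two off-diagonal entries in one column of
  \<open>u v\<^sup>T\<close> expresses each of \<open>s * (a$2 - a$3)\<close>, \<open>s * (a$3 - a$1)\<close>, \<open>s * (a$1 - a$2)\<close> as
  an entry of \<open>v\<close> times a \<open>2 \<times> 2\<close> minor of \<open>a\<close> and \<open>u\<close>; inserting them turns
  \<open>s * conic_form a v\<close> into \<open>v$1 * v$2 * v$3\<close> times the determinant of \<open>a, a, u\<close>. The second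
  claim is the cyclic identity with \<open>s\<close> and \<open>t\<close> nonzero: if one conic form vanished, so
  would the other, and \<open>b\<close> would be a multiple of \<open>a\<close>.
\<close>

lemma rank_deficient_new_pair:
  fixes x y :: "5 \<Rightarrow> proj_plane"
  assumes X: "proj_frame x M a i j l m k" and Y: "proj_frame y N b i j l m k"
    and gp: "pairs_general_position x y"
    and new: "is_new_pair x y p q" and rank: "rank (Z6 x y p q) < 6"
  shows "q \<in> image_conic x y k" "y k \<notin> image_conic x y k"
proof -
  have M: "invertible M" "invertible N"
    and ab: "a$1 \<noteq> a$2" "a$1 \<noteq> a$3" "a$2 \<noteq> a$3" "b$1 \<noteq> b$2"
    using X Y by (auto simp: proj_frame_def)
  obtain u where u: "u \<noteq> 0" "p = pt (M *v u)" using pt_coordinates[OF M(1)] .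
  obtain v where v: "v \<noteq> 0" "q = pt (N *v v)" using pt_coordinates[OF M(2)] .
  obtain s t where "\<forall>g h. g \<noteq> h \<longrightarrow> u $ g * v $ h = s + t * a $ g * b $ h"
    using rank unfolding u(2) v(2) rank_Z6_less_iff[OF X Y u(1) v(1)] by (elim exE)
  then have off: "u $ g * v $ h = s + t * a $ g * b $ h" if "g \<noteq> h" for g h
    using that by simp
  have st: "s \<noteq> 0" "t \<noteq> 0"
    using new_pair_coefficients_nonzero[OF X Y u(1) v(1)] new off u v by auto
  have 12: "u$1 * v$2 = s + t * a$1 * b$2" and 13: "u$1 * v$3 = s + t * a$1 * b$3"
   and 21: "u$2 * v$1 = s + t * a$2 * b$1" and 23: "u$2 * v$3 = s + t * a$2 * b$3"
   and 31: "u$3 * v$1 = s + t * a$3 * b$1" and 32: "u$3 * v$2 = s + t * a$3 * b$2"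
    using off by auto
  have e: "s * (a$2 - a$3) = v$1 * (a$2 * u$3 - a$3 * u$2)"
    "s * (a$3 - a$1) = v$2 * (a$3 * u$1 - a$1 * u$3)"
    "s * (a$1 - a$2) = v$3 * (a$1 * u$2 - a$2 * u$1)"
    using 12 13 21 23 31 32 by algebra+
  have "s * conic_form a v = a$1 * (s * (a$2 - a$3)) * v$2 * v$3
      + a$2 * (s * (a$3 - a$1)) * v$1 * v$3 + a$3 * (s * (a$1 - a$2)) * v$1 * v$2"
    by (simp add: conic_form_def algebra_simps)
  also have "\<dots> = 0" unfolding e by (simp add: algebra_simps)
  finally have "conic_form a v = 0" using st by simp
  then show "q \<in> image_conic x y k" using mem_image_conic[OF X Y v(1)] v(2) by simp
  have "(u$1 * v$2) * (u$2 * v$3) * (u$3 * v$1) - (u$2 * v$1) * (u$3 * v$2) * (u$1 * v$3) = 0"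
    by simp
  then have 0: "t * conic_form a b = s * unit_conic_form a b (vector [1, 1, 1])"
    unfolding 12 13 21 23 31 32 cyclic_product_identity using st by simp
  show "y k \<notin> image_conic x y k"
    unfolding own_point_last[OF X Y]
  proof
    assume z: "conic_form a b = 0"
    then have "unit_conic_form a b (vector [1, 1, 1]) = 0" using 0 st by simp
    then obtain c where "b = c *s a" using forms_vanish_imp_proportional[OF z _ ab] by blast
    then show False using last_coordinates_not_proportional[OF X Y gp] by blast
  qed
qed

text \<open>
  A common point is none of \<open>y i, y j, y l\<close>, because each of these misses its own conic; on
  the conic for \<open>k\<close> all its coordinates are then nonzero. Multiplying the reciprocals of the
  coordinates by their common denominator gives a vector \<open>(v$2 * v$3, v$1 * v$3, v$1 * v$2)\<close>
  on two lines. One line contains \<open>(1, 1, 1)\<close> and the other does not, since \<open>y m\<close> misses its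
  own conic, so the lines are distinct and meet in one point.
\<close>

lemma common_point_unique:
  assumes X: "proj_frame x M a i j l m k" and Y: "proj_frame y N b i j l m k"
    and own: "\<And>n. y n \<notin> image_conic x y n"
    and p: "\<And>n. p \<in> image_conic x y n" and q: "\<And>n. q \<in> image_conic x y n"
  shows "p = q"
proof -
  have N: "invertible N" and a: "a$1 \<noteq> 0" "a$2 \<noteq> 0" "a$3 \<noteq> 0" "a$1 \<noteq> a$2" "a$1 \<noteq> a$3" "a$2 \<noteq> a$3"
    and y: "y i = pt (N *v vector [1, 0, 0])" "y j = pt (N *v vector [0, 1, 0])"
     "y l = pt (N *v vector [0, 0, 1])"
    using X Y by (auto simp: proj_frame_def)
  have coord: "\<exists>v. v \<noteq> 0 \<and> r = pt (N *v v) \<and> v$1 \<noteq> 0 \<and> v$2 \<noteq> 0 \<and> v$3 \<noteq> 0 \<and>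
      conic_form a v = 0 \<and> unit_conic_form a b v = 0"
    if r: "\<And>n. r \<in> image_conic x y n" for r
  proof -
    obtain v where v: "v \<noteq> 0" "r = pt (N *v v)" using pt_coordinates[OF N] .
    have forms: "conic_form a v = 0" "unit_conic_form a b v = 0"
      using r mem_image_conic[OF X Y v(1)] mem_image_conic_fourth[OF X Y v(1)] v(2) by auto
    have "r \<noteq> y i" "r \<noteq> y j" "r \<noteq> y l" using r own by metis+
    then have no: "\<And>c. v \<noteq> c *s vector [1,0,0]" "\<And>c. v \<noteq> c *s vector [0,1,0]" "\<And>c. v \<noteq> c *s vector [0,0,1]"
      unfolding y v(2) using pt_mult_scale[OF N _ _ refl] v(1) proj_frame_vectors_nonzero(1-3)
      by (metis vector_smult_lzero)+
    have "\<not> (v$2 = 0 \<and> v$3 = 0)" "\<not> (v$1 = 0 \<and> v$3 = 0)" "\<not> (v$1 = 0 \<and> v$2 = 0)"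
      using no(1)[of "v$1"] no(2)[of "v$2"] no(3)[of "v$3"]
      by (auto simp: complex_vec3_eq_iff vector_3)
    then have "v$1 \<noteq> 0" "v$2 \<noteq> 0" "v$3 \<noteq> 0"
      using forms(1) a by (auto simp: conic_form_def)
    then show ?thesis using v forms by blast
  qed
  obtain v where v: "v \<noteq> 0" "p = pt (N *v v)" "v$1 \<noteq> 0" "v$2 \<noteq> 0" "v$3 \<noteq> 0"
    "conic_form a v = 0" "unit_conic_form a b v = 0" using coord[OF p] by blast
  obtain w where w: "w \<noteq> 0" "q = pt (N *v w)" "w$1 \<noteq> 0" "w$2 \<noteq> 0" "w$3 \<noteq> 0"
    "conic_form a w = 0" "unit_conic_form a b w = 0" using coord[OF q] by blast
  have P: "unit_conic_form a b (vector [1,1,1]) \<noteq> 0"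
    using own[of m] own_point_fourth[OF X Y] by blast
  have f: "a$1 * (a$2 - a$3) * (v$2 * v$3) + a$2 * (a$3 - a$1) * (v$1 * v$3) + a$3 * (a$1 - a$2) * (v$1 * v$2) = 0"
    "a$1 * (a$2 - a$3) * (w$2 * w$3) + a$2 * (a$3 - a$1) * (w$1 * w$3) + a$3 * (a$1 - a$2) * (w$1 * w$2) = 0"
    "b$1 * (a$2 - a$3) * (v$2 * v$3) + b$2 * (a$3 - a$1) * (v$1 * v$3) + b$3 * (a$1 - a$2) * (v$1 * v$2) = 0"
    "b$1 * (a$2 - a$3) * (w$2 * w$3) + b$2 * (a$3 - a$1) * (w$1 * w$3) + b$3 * (a$1 - a$2) * (w$1 * w$2) = 0"
    using v(6,7) w(6,7) by (simp_all add: conic_form_def unit_conic_form_def mult.assoc)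
  \<comment> \<open>Two lines \<open>n\<close> and \<open>m\<close>, only the first of them through \<open>(1, 1, 1)\<close>, meet in one point.\<close>
  have unique: "r2 * s1 = r1 * s2 \<and> r3 * s1 = r1 * s3"
    if "n1 * r1 + n2 * r2 + n3 * r3 = 0" "n1 * s1 + n2 * s2 + n3 * s3 = 0"
      "m1 * r1 + m2 * r2 + m3 * r3 = 0" "m1 * s1 + m2 * s2 + m3 * s3 = 0"
      "n1 + n2 + n3 = 0" "m1 + m2 + m3 \<noteq> 0" "n1 \<noteq> 0"
    for n1 n2 n3 m1 m2 m3 r1 r2 r3 s1 s2 s3 :: complex
  proof -
    have "n1 * ((m1 + m2 + m3) * (r2 * s1 - r1 * s2)) = 0" "n1 * ((m1 + m2 + m3) * (r3 * s1 - r1 * s3)) = 0"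
      using that(1-5) by algebra+
    then show ?thesis using that by simp
  qed
  have "v$1 * v$3 * (w$2 * w$3) = v$2 * v$3 * (w$1 * w$3) \<and> v$1 * v$2 * (w$2 * w$3) = v$2 * v$3 * (w$1 * w$2)"
  proof (rule unique[OF f(1) f(2) f(3) f(4)])
    show "a$1 * (a$2 - a$3) + a$2 * (a$3 - a$1) + a$3 * (a$1 - a$2) = 0" by algebra
    show "b$1 * (a$2 - a$3) + b$2 * (a$3 - a$1) + b$3 * (a$1 - a$2) \<noteq> 0"
      using P by (simp add: unit_conic_form_def vector_3)
  qed (use a in auto)
  then have "v$1 * w$2 = v$2 * w$1" "v$1 * w$3 = v$3 * w$1" using v(3-5) w(3-5) by auto
  then have "w = (w$1 / v$1) *s v" using v(3) by (simp add: complex_vec3_eq_iff field_simps)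
  then show "p = q"
    using pt_mult_eq_iff[OF N v(1) w(1)] v(2,3) w(2,3) by (metis divide_eq_0_iff)
qed

text \<open>
  The choice of \<open>s\<close> and \<open>t\<close> makes the two cyclic products of the prescribed entries \<open>c p q\<close>
  equal. No entry is zero: a zero entry would force a zero in the other cyclic product,
  hence two equal entries among those shown to differ below; for entries in transposed
  positions this uses that \<open>y i, y j, y l\<close> miss their own conics. Six nonzero off-diagonal
  entries with equal cyclic products complete to a matrix \<open>u v\<^sup>T\<close>.
\<close>

lemma rank_deficient_new_pair_exists:
  fixes x y :: "5 \<Rightarrow> proj_plane"
  assumes X: "proj_frame x M a i j l m k" and Y: "proj_frame y N b i j l m k"
    and own: "\<And>n. y n \<notin> image_conic x y n"
  obtains p q where "is_new_pair x y p q" "rank (Z6 x y p q) < 6"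
proof -
  have M: "invertible M" "invertible N" and UN: "UNIV = {i, j, l, m, k}"
    and a: "a$1 \<noteq> 0" "a$2 \<noteq> 0" "a$3 \<noteq> 0" "a$1 \<noteq> a$2" "a$1 \<noteq> a$3" "a$2 \<noteq> a$3"
    and b: "b$1 \<noteq> 0" "b$2 \<noteq> 0" "b$3 \<noteq> 0" "b$1 \<noteq> b$2" "b$1 \<noteq> b$3" "b$2 \<noteq> b$3"
    and nz: "a \<noteq> 0" "b \<noteq> 0"
    using X Y by (auto simp: proj_frame_def proj_frame_vectors_nonzero)
  define s where "s = conic_form a b"
  define t where "t = unit_conic_form a b (vector [1, 1, 1])"
  define c where "c p q = s + t * a$p * b$q" for p q
  have st: "s \<noteq> 0" "t \<noteq> 0"
    using own own_point_last[OF X Y] own_point_fourth[OF X Y] by (auto simp: s_def t_def)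
  have minors: "a$1 * b$2 \<noteq> a$2 * b$1" "a$1 * b$3 \<noteq> a$3 * b$1" "a$2 * b$3 \<noteq> a$3 * b$2"
    using own own_point_first[OF X Y] own_point_second[OF X Y] own_point_third[OF X Y] by auto
  have cyc: "c 1 2 * c 2 3 * c 3 1 = c 2 1 * c 3 2 * c 1 3"
    using cyclic_product_identity[of s t a b] by (simp add: c_def s_def t_def)
  have diff: "c p q \<noteq> c p' q'" if "a$p * b$q \<noteq> a$p' * b$q'" for p q p' q'
    using that st by (simp add: c_def mult.assoc)
  have d: "c 1 2 \<noteq> c 2 1" "c 1 3 \<noteq> c 3 1" "c 2 3 \<noteq> c 3 2" "c 1 2 \<noteq> c 1 3" "c 2 1 \<noteq> c 2 3"
      "c 3 1 \<noteq> c 3 2" "c 1 2 \<noteq> c 3 2" "c 1 3 \<noteq> c 2 3" "c 2 1 \<noteq> c 3 1"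
    by (intro diff; use minors a b in simp)+
  have cnz: "c 1 2 \<noteq> 0" "c 1 3 \<noteq> 0" "c 2 1 \<noteq> 0" "c 2 3 \<noteq> 0" "c 3 1 \<noteq> 0" "c 3 2 \<noteq> 0"
    using cyc d by auto
  define u :: "complex^3" where "u = vector [c 1 3, c 2 3, c 3 1 * c 2 3 / c 2 1]"
  define v :: "complex^3" where "v = vector [c 2 1 / c 2 3, c 1 2 / c 1 3, 1]"
  have unz: "u$1 \<noteq> 0" "u$2 \<noteq> 0" "u$3 \<noteq> 0" and vnz: "v$1 \<noteq> 0" "v$2 \<noteq> 0" "v$3 \<noteq> 0"
    using cnz by (simp_all add: u_def v_def vector_3)
  have uv0: "u \<noteq> 0" "v \<noteq> 0" using unz vnz by auto
  have off: "u $ p * v $ q = c p q" if "p \<noteq> q" for p q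
    using that exhaust_3[of p] exhaust_3[of q] cnz cyc
    by (auto simp: u_def v_def vector_3 divide_simps) (simp_all add: mult_ac)
  have rank: "rank (Z6 x y (pt (M *v u)) (pt (N *v v))) < 6"
    unfolding rank_Z6_less_iff[OF X Y uv0]
    by (intro exI[of _ s] exI[of _ t]) (simp add: off c_def)
  have "is_new_pair x y (pt (M *v u)) (pt (N *v v))"
  proof -
    \<comment> \<open>\<open>u\<close> has no zero coordinate, so its point differs from \<open>e1, e2, e3\<close>\<close>
    have ne: "pt (M *v u) \<noteq> pt (M *v e)" if "e \<noteq> 0" "e$1 = 0 \<or> e$2 = 0" for e
      using pt_mult_eq_iff[OF M(1) that(1) uv0(1)] unz(1,2) that(2) by auto
    have "\<not> (pt (M *v u) = pt (M *v vector [1,1,1]) \<and> pt (N *v v) = pt (N *v vector [1,1,1]))"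
    proof
      assume "pt (M *v u) = pt (M *v vector [1,1,1]) \<and> pt (N *v v) = pt (N *v vector [1,1,1])"
      then obtain r r' where "vector [1,1,1] = r *s u" "vector [1,1,1] = r' *s v"
        using pt_mult_eq_iff[OF M(1) uv0(1) proj_frame_vectors_nonzero(4)]
          pt_mult_eq_iff[OF M(2) uv0(2) proj_frame_vectors_nonzero(4)] by blast
      then have "r * u$1 = 1" "r' * v$2 = 1" "r' * v$3 = 1"
        by (simp_all add: complex_vec3_eq_iff vector_3)
      then have "u$1 * v$2 = u$1 * v$3" by algebra
      then show False using off[of 1 2] off[of 1 3] d by simp
    qed
    moreover have "\<not> (pt (M *v u) = pt (M *v a) \<and> pt (N *v v) = pt (N *v b))"
    proof
      assume "pt (M *v u) = pt (M *v a) \<and> pt (N *v v) = pt (N *v b)"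
      then obtain r r' where "a = r *s u" "b = r' *s v"
        using pt_mult_eq_iff[OF M(1) uv0(1) nz(1)] pt_mult_eq_iff[OF M(2) uv0(2) nz(2)] by blast
      then have "a$1 = r * u$1" "b$2 = r' * v$2" "b$3 = r' * v$3" by simp_all
      then have "b$3 * (u$1 * v$2) = b$2 * (u$1 * v$3)" by algebra
      then have "s * (b$3 - b$2) = 0"
        unfolding off[of 1 2, simplified] off[of 1 3, simplified] c_def by algebra
      then show False using st b by simp
    qed
    moreover have "pt (M *v u) \<noteq> pt (M *v vector [1,0,0])" "pt (M *v u) \<noteq> pt (M *v vector [0,1,0])"
      "pt (M *v u) \<noteq> pt (M *v vector [0,0,1])"
      by (intro ne; simp add: proj_frame_vectors_nonzero vector_3)+
    moreover have "x i = pt (M *v vector [1,0,0])" "x j = pt (M *v vector [0,1,0])"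
      "x l = pt (M *v vector [0,0,1])" "x m = pt (M *v vector [1,1,1])" "x k = pt (M *v a)"
      "y m = pt (N *v vector [1,1,1])" "y k = pt (N *v b)"
      using X Y by (simp_all add: proj_frame_def)
    ultimately have "\<forall>n\<in>UNIV. (pt (M *v u), pt (N *v v)) \<noteq> (x n, y n)"
      unfolding UN by simp
    then show ?thesis by (simp add: is_new_pair_def)
  qed
  then show thesis using rank by (rule that)
qed

section \<open>The intersections of the conics\<close>

lemma proj_frames_exist:
  fixes x y :: "5 \<Rightarrow> proj_plane"
  assumes "pairs_general_position x y"
  obtains M a N b i j l m where "proj_frame x M a i j l m k" "proj_frame y N b i j l m k"
proof -
  obtain ns :: "5 list" where ns: "set ns = UNIV - {k}" "distinct ns"
    using finite_distinct_list[of "UNIV - {k}"] by auto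
  then have "length ns = 4" using distinct_card[of ns] by simp
  then obtain i j l m where "ns = [i, j, l, m]"
    by (auto simp: numeral_eq_Suc length_Suc_conv)
  then have d: "distinct [i, j, l, m, k]" and UN: "UNIV = {i, j, l, m, k}" using ns by auto
  show thesis
    using proj_frame_exists[OF _ d UN, of x] proj_frame_exists[OF _ d UN, of y] assms that
    unfolding pairs_general_position_def by metis
qed

lemma rank_Z6_swap:
  fixes x y :: "5 \<Rightarrow> proj_plane"
  shows "rank (Z6 y x v u) < 6 \<longleftrightarrow> rank (Z6 x y u v) < 6"
proof -
  have "kron_dependent V U" if "kron_dependent U V" for U V :: "5 option \<Rightarrow> complex^3"
  proof -
    obtain c where c: "\<exists>r. c r \<noteq> 0" "\<And>p q. (\<Sum>r\<in>UNIV. c r * U r $ p * V r $ q) = 0"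
      using \<open>kron_dependent U V\<close> unfolding kron_dependent_def by blast
    have "(\<Sum>r\<in>UNIV. c r * V r $ p * U r $ q) = 0" for p q
      using c(2)[of q p] by (simp add: mult_ac)
    then show ?thesis unfolding kron_dependent_def using c(1) by blast
  qed
  then show ?thesis unfolding rank_Z6_iff_kron_dependent by blast
qed

lemma Inter_image_conic:
  fixes x y :: "5 \<Rightarrow> proj_plane"
  assumes gp: "pairs_general_position x y" and new: "is_new_pair x y p q"
    and rank: "rank (Z6 x y p q) < 6"
  shows "(\<Inter>k. image_conic x y k) = {q}"
proof -
  have mem: "q \<in> image_conic x y k" and own: "y k \<notin> image_conic x y k" for k
    using proj_frames_exist[OF gp, of k] rank_deficient_new_pair[OF _ _ gp new rank] by metis+
  have "r = q" if "\<And>k. r \<in> image_conic x y k" for r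
    using proj_frames_exist[OF gp] common_point_unique[OF _ _ own that mem] by metis
  then show ?thesis using mem by auto
qed

lemma Inter_image_conic_swap:
  fixes x y :: "5 \<Rightarrow> proj_plane"
  assumes "pairs_general_position x y" "is_new_pair x y p q" "rank (Z6 x y p q) < 6"
  shows "(\<Inter>k. image_conic y x k) = {p}"
  using assms by (intro Inter_image_conic[where p = q])
    (auto simp: pairs_general_position_sym rank_Z6_swap is_new_pair_def)

text \<open>
  In a frame that omits \<open>k\<close> the conditions \<open>y k \<in> C' k\<close> and \<open>x k \<in> C k\<close> read
  \<open>conic_form a b = 0\<close> and \<open>conic_form b a = 0\<close>, and \<open>conic_form\<close> is antisymmetric. All
  other conics of the two families contain these points by construction.
\<close>

lemma own_point_imp_common_point:
  fixes x y :: "5 \<Rightarrow> proj_plane"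
  assumes gp: "pairs_general_position x y" and own: "y k \<in> image_conic x y k"
  shows "y k \<in> (\<Inter>n. image_conic x y n)" "x k \<in> (\<Inter>n. image_conic y x n)"
proof -
  have "x k \<in> image_conic y x k"
  proof -
    obtain M a N b i j l m where F: "proj_frame x M a i j l m k" "proj_frame y N b i j l m k"
      using proj_frames_exist[OF gp] .
    have "conic_form b a = - conic_form a b" by (simp add: conic_form_def algebra_simps)
    then show ?thesis using own own_point_last[OF F] own_point_last[OF F(2,1)] by simp
  qed
  moreover have "y k \<in> image_conic x y n" "x k \<in> image_conic y x n" if "k \<noteq> n" for n
    using proj_frames_exist[OF gp, of n] mem_image_conic_other[OF _ _ that] by metis+
  ultimately show "y k \<in> (\<Inter>n. image_conic x y n)" "x k \<in> (\<Inter>n. image_conic y x n)"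
    using own by (auto, metis+)
qed

theorem theorem6p21:
  fixes x y :: "5 \<Rightarrow> proj_plane"
    and x6 y6 :: proj_plane
  assumes "pairs_general_position x y"
    and "is_new_pair x y x6 y6"
  defines "H \<equiv> \<lambda>i. homography_except x y i"
    and "G \<equiv> \<lambda>j. homography_except y x j"
  defines "C' \<equiv> \<lambda>i. H i ` conic_through x"
    and "C \<equiv> \<lambda>j. G j ` conic_through y"
  shows "(rank (Z6 x y x6 y6) < 6 \<and>
          (\<forall>u v. is_new_pair x y u v \<and> rank (Z6 x y u v) < 6 \<longrightarrow> u = x6 \<and> v = y6))
     \<longleftrightarrow> ((\<Inter>i. C' i) = {y6} \<and> (\<Inter>j. C j) = {x6})"
proof -
  note gp = assms(1) and new = assms(2)
  have common: "(\<Inter>i. C' i) = {v} \<and> (\<Inter>j. C j) = {u}"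
    if "is_new_pair x y u v" "rank (Z6 x y u v) < 6" for u v
    using Inter_image_conic[OF gp that] Inter_image_conic_swap[OF gp that]
    by (simp add: C'_def C_def H_def G_def)
  show ?thesis
  proof
    assume "rank (Z6 x y x6 y6) < 6 \<and>
      (\<forall>u v. is_new_pair x y u v \<and> rank (Z6 x y u v) < 6 \<longrightarrow> u = x6 \<and> v = y6)"
    then show "(\<Inter>i. C' i) = {y6} \<and> (\<Inter>j. C j) = {x6}" using common[OF new] by blast
  next
    assume R: "(\<Inter>i. C' i) = {y6} \<and> (\<Inter>j. C j) = {x6}"
    have own: "y k \<notin> image_conic x y k" for k
    proof
      assume "y k \<in> image_conic x y k"
      then have "y k \<in> (\<Inter>i. C' i)" "x k \<in> (\<Inter>j. C j)"
        using own_point_imp_common_point[OF gp] by (simp_all add: C'_def C_def H_def G_def)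
      then have "y k = y6" "x k = x6" using R by simp_all
      then show False using new unfolding is_new_pair_def by metis
    qed
    obtain u v where uv: "is_new_pair x y u v" "rank (Z6 x y u v) < 6"
      using proj_frames_exist[OF gp] rank_deficient_new_pair_exists[OF _ _ own] by metis
    have unique: "u' = x6 \<and> v' = y6" if "is_new_pair x y u' v'" "rank (Z6 x y u' v') < 6" for u' v'
      using common[OF that] R by simp
    then show "rank (Z6 x y x6 y6) < 6 \<and>
      (\<forall>u v. is_new_pair x y u v \<and> rank (Z6 x y u v) < 6 \<longrightarrow> u = x6 \<and> v = y6)"
      using uv by blast
  qed
qed

end
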